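(* The B-Z constant of the family $\mathcal{C}_3=\{C_n^3 : n\ge 7\}$ of third powers of cycles exists and equals $$BZ(\mathcal{C}_3)=\lim_{n\to\infty}\frac{\sum_{T\in\mathcal{T}(C_n^3)}|\mathcal{L}(T)|}{n\cdot\tau(C_n^3)}=\frac37 \left(\frac{45}2 + 9 \sqrt{7} - \frac12 \sqrt{3857 + 1684 \sqrt{7}}\right).$$
   Context: All graphs are finite and simple. $C_n$ is the cycle graph on $n$ vertices. For a graph $G$ and $k\ge1$, the $k$-th power $G^k$ has $V(G^k)=V(G)$, and $uv$ is an edge iff the distance between $u$ and $v$ in $G$ is at least $1$ and at most $k$. $\mathcal{T}(G)$ is the set of labeled spanning trees of $G$, $\tau(G)=|\mathcal{T}(G)|$, and $\mathcal{L}(T)$ is the set of leaves (vertices of degree exactly $1$ in $T$) of a tree $T$. For a graph family $\mathcal{G}$ indexed by number of vertices, with $G_n$ the member on $n$ vertices, the B-Z constant is $BZ(\mathcal{G}):=\lim_{n\to\infty}\frac{\sum_{T\in\mathcal{T}(G_n)}|\mathcal{L}(T)|}{n\,\tau(G_n)}$ whenever the limit exists. *)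

theory Defs
  imports Complex_Main "HOL-Library.Extended_Nat"
begin

record 'a graph =
  verts :: "'a set"
  edges :: "'a set set"

definition simple_graph :: "'a graph \<Rightarrow> bool" where
  "simple_graph G \<longleftrightarrow> finite (verts G) \<and>
     (\<forall>e\<in>edges G. \<exists>u\<in>verts G. \<exists>v\<in>verts G. u \<noteq> v \<and> e = {u, v})"

definition walk :: "'a graph \<Rightarrow> 'a \<Rightarrow> 'a list \<Rightarrow> 'a \<Rightarrow> bool" where
  "walk G u xs v \<longleftrightarrow> xs \<noteq> [] \<and> hd xs = u \<and> last xs = v \<and> set xs \<subseteq> verts G \<and>
     successively (\<lambda>x y. {x, y} \<in> edges G) xs"

(* A walk is given by its list of vertices, so its number of edges is one less than the
   length of the list. The infimum over no walk at all is infinity. *)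
definition graph_dist :: "'a graph \<Rightarrow> 'a \<Rightarrow> 'a \<Rightarrow> enat" where
  "graph_dist G u v = (INF xs\<in>{xs. walk G u xs v}. enat (length xs - 1))"

definition graph_power :: "'a graph \<Rightarrow> nat \<Rightarrow> 'a graph" where
  "graph_power G k =
     \<lparr>verts = verts G,
      edges = {{u, v} |u v. u \<in> verts G \<and> v \<in> verts G \<and>
                 1 \<le> graph_dist G u v \<and> graph_dist G u v \<le> enat k}\<rparr>"

(* A cycle graph only for n at least 3; smaller n give loops or a single edge. *)
definition cycle_graph :: "nat \<Rightarrow> nat graph" where
  "cycle_graph n = \<lparr>verts = {..<n}, edges = {{i, (i + 1) mod n} |i. i < n}\<rparr>"

definition graph_connected :: "'a graph \<Rightarrow> bool" where
  "graph_connected G \<longleftrightarrow> verts G \<noteq> {} \<and> (\<forall>u\<in>verts G. \<forall>v\<in>verts G. \<exists>xs. walk G u xs v)"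

(* The cycle is listed without repeating its first vertex. *)
definition is_cycle :: "'a graph \<Rightarrow> 'a list \<Rightarrow> bool" where
  "is_cycle G xs \<longleftrightarrow> 3 \<le> length xs \<and> distinct xs \<and> walk G (hd xs) xs (last xs) \<and>
     {last xs, hd xs} \<in> edges G"

definition is_tree :: "'a graph \<Rightarrow> bool" where
  "is_tree T \<longleftrightarrow> simple_graph T \<and> graph_connected T \<and> (\<nexists>xs. is_cycle T xs)"

definition spanning_trees :: "'a graph \<Rightarrow> 'a graph set" where
  "spanning_trees G = {T. is_tree T \<and> verts T = verts G \<and> edges T \<subseteq> edges G}"

definition num_spanning_trees :: "'a graph \<Rightarrow> nat" where
  "num_spanning_trees G = card (spanning_trees G)"

definition degree :: "'a graph \<Rightarrow> 'a \<Rightarrow> nat" where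
  "degree G v = card {e \<in> edges G. v \<in> e}"

definition leaves :: "'a graph \<Rightarrow> 'a set" where
  "leaves T = {v \<in> verts T. degree T v = 1}"

(* A family is a function sending n to its member on n vertices. Values at indices where the
   family has no member are irrelevant, as only limits in n are taken. *)
definition BZ_seq :: "(nat \<Rightarrow> 'a graph) \<Rightarrow> nat \<Rightarrow> real" where
  "BZ_seq \<G> n =
     real (\<Sum>T\<in>spanning_trees (\<G> n). card (leaves T)) / (real n * real (num_spanning_trees (\<G> n)))"

definition BZ :: "(nat \<Rightarrow> 'a graph) \<Rightarrow> real" where
  "BZ \<G> = lim (BZ_seq \<G>)"

(* The value of lim is meaningful only for convergent sequences. *)
definition BZ_exists :: "(nat \<Rightarrow> 'a graph) \<Rightarrow> bool" where
  "BZ_exists \<G> \<longleftrightarrow> convergent (BZ_seq \<G>)"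

lemma simple_graph_cycle_graph: "3 \<le> n \<Longrightarrow> simple_graph (cycle_graph n)"
proof -
  assume n: "3 \<le> n"
  have neq: "i \<noteq> (i + 1) mod n" if "i < n" for i
  proof (cases "i + 1 = n")
    case False
    then have "(i + 1) mod n = i + 1" using that by (intro mod_less) linarith
    then show ?thesis by linarith
  qed (use n in simp)
  have less: "(i + 1) mod n < n" for i using n by simp
  show ?thesis
    unfolding simple_graph_def
  proof (intro conjI ballI)
    fix e assume "e \<in> edges (cycle_graph n)"
    then obtain i where i: "i < n" "e = {i, (i + 1) mod n}"
      by (auto simp: cycle_graph_def)
    then have "i \<in> verts (cycle_graph n)" "(i + 1) mod n \<in> verts (cycle_graph n)"
      using less by (simp_all add: cycle_graph_def)
    with i neq show "\<exists>u\<in>verts (cycle_graph n). \<exists>v\<in>verts (cycle_graph n). u \<noteq> v \<and> e = {u, v}"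
      by blast
  qed (simp add: cycle_graph_def)
qed

lemma graph_dist_self: "v \<in> verts G \<Longrightarrow> graph_dist G v v = 0"
proof -
  assume "v \<in> verts G"
  then have "walk G v [v] v" by (simp add: walk_def)
  then have "graph_dist G v v \<le> enat (length [v] - 1)"
    unfolding graph_dist_def by (intro INF_lower) simp
  then show ?thesis by (simp add: zero_enat_def[symmetric])
qed

lemma simple_graph_graph_power:
  assumes "simple_graph G"
  shows "simple_graph (graph_power G k)"
  unfolding simple_graph_def
proof (intro conjI ballI)
  fix e assume "e \<in> edges (graph_power G k)"
  then obtain u v where uv: "u \<in> verts G" "v \<in> verts G" "1 \<le> graph_dist G u v" "e = {u, v}"
    by (auto simp: graph_power_def)
  then have "u \<noteq> v" using graph_dist_self[of u G] by auto
  with uv show "\<exists>u\<in>verts (graph_power G k). \<exists>v\<in>verts (graph_power G k). u \<noteq> v \<and> e = {u, v}"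
    unfolding graph_power_def by auto
qed (use assms in \<open>simp add: simple_graph_def graph_power_def\<close>)

lemma finite_spanning_trees:
  assumes "simple_graph G"
  shows "finite (spanning_trees G)"
proof -
  have "finite (edges G)"
    using assms by (intro finite_subset[of "edges G" "Pow (verts G)"]) (auto simp: simple_graph_def)
  moreover have "spanning_trees G \<subseteq> (\<lambda>E. \<lparr>verts = verts G, edges = E\<rparr>) ` Pow (edges G)"
  proof
    fix T assume "T \<in> spanning_trees G"
    then have "T = \<lparr>verts = verts G, edges = edges T\<rparr>" "edges T \<in> Pow (edges G)"
      by (simp_all add: spanning_trees_def)
    then show "T \<in> (\<lambda>E. \<lparr>verts = verts G, edges = E\<rparr>) ` Pow (edges G)" by blast
  qed
  ultimately show ?thesis by (meson finite_Pow_iff finite_imageI finite_subset)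
qed

end

theory Submission
  imports Defs "Jordan_Normal_Form.Determinant"
begin

text \<open>Fix a vertex \<open>v\<close> and give every edge at \<open>v\<close> the weight \<open>s\<close> and every other edge the weight \<open>1\<close>.
  The weighted number of spanning trees is then \<open>F s = (\<Sum>T. s ^ degree T v)\<close>, so \<open>F 1\<close> counts the
  spanning trees and the derivative of \<open>F\<close> at \<open>0\<close> counts those in which \<open>v\<close> is a leaf. Rotations act
  transitively on a power of a cycle, hence every vertex is a leaf of equally many trees, and the
  average proportion of leaves is the ratio of \<open>deriv F 0\<close> to \<open>F 1\<close>
  (\<open>BZ_seq_cycle_power\<close>, \<open>has_real_derivative_sum_power_at_0\<close>).

  By the matrix tree theorem (\<open>weighted_matrix_tree\<close>), \<open>F s\<close> is the determinant of
  \<open>M - (1 - s) D\<close>, where \<open>M\<close> is the Laplacian with the row and the column of \<open>v\<close> removed and \<open>D\<close> is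
  the diagonal indicator matrix of the six neighbours of \<open>v\<close>. The perturbation has rank \<open>6\<close>, so
  \<open>F s / F 1\<close> is the determinant of \<open>I - (1 - s) H\<close>, where \<open>H\<close> is the restriction of the inverse of
  \<open>M\<close> to the neighbours of \<open>v\<close>. The reflection that fixes \<open>v\<close> splits this determinant into two
  determinants of size \<open>3\<close> (\<open>potential_kernel.det_lap\<close>).

  The inverse of \<open>M\<close> has the entries \<open>a (x - v) + a (y - v) - a (x - y)\<close>, where \<open>a\<close> is the
  potential kernel of the cyclic group: the even function that vanishes at \<open>0\<close> and whose
  Laplacian is \<open>1 / n\<close> minus the indicator of \<open>0\<close>. If \<open>X\<close> stands for the
  operator \<open>f \<mapsto> (\<lambda>x. f (x + 1) + f (x - 1))\<close>, then the Laplacian is \<open>- (X - 2) (X^2 + 3 X + 4)\<close>, and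
  inverting the factors by partial fractions gives \<open>a\<close> explicitly (\<open>potential_laplace\<close>): up to a constant, a parabola plus the
  real part of a multiple of \<open>\<rho> ^ k + \<rho> ^ (n - k)\<close>, where \<open>\<rho> + 1 / \<rho>\<close> is a root of
  \<open>X^2 + 3 X + 4\<close> and \<open>\<rho>\<close> has norm less than \<open>1\<close>.

  As \<open>n\<close> grows, the values of \<open>a\<close> at \<open>1, ..., 6\<close> converge to elements of the field generated by
  \<open>sqrt 7\<close> and \<open>sqrt (sqrt 7 + 7 / 4)\<close> (\<open>potential_tendsto_limit_potential\<close>), and the proportion of
  leaves is a polynomial in these values, whose value at the limit is computed in that
  field (\<open>leaf_fraction_limit_potential\<close>).\<close>

section \<open>Walks and trees given by parent functions\<close>

lemma walk_Cons_Cons: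
  "walk G u (x # y # xs) v \<longleftrightarrow> u = x \<and> x \<in> verts G \<and> {x, y} \<in> edges G \<and> walk G y (y # xs) v"
  by (auto simp: walk_def)

lemma walk_append_tl:
  assumes "walk G u xs v" "walk G v ys w"
  shows "walk G u (xs @ tl ys) w"
proof (cases "tl ys = []")
  case True
  then have "ys = [v]" "w = v" using assms(2) by (cases ys; auto simp: walk_def)+
  then show ?thesis using assms(1) by simp
next
  case False
  then obtain y zs where ys: "ys = v # y # zs"
    using assms(2) by (cases ys; cases "tl ys") (auto simp: walk_def)
  show ?thesis using assms unfolding ys
    by (auto simp: walk_def successively_append_iff)
qed

lemma walk_rev: "walk G u xs v \<Longrightarrow> walk G v (rev xs) u"
  by (auto simp: walk_def hd_rev last_rev successively_rev insert_commute)

lemma distinct_walk_exists: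
  assumes "walk G u xs v"
  shows "\<exists>ys. walk G u ys v \<and> distinct ys"
  using assms
proof (induction "length xs" arbitrary: xs rule: less_induct)
  case less
  show ?case
  proof (cases "distinct xs")
    case False
    then obtain as y bs cs where xs: "xs = as @ [y] @ bs @ [y] @ cs"
      using not_distinct_decomp by blast
    have "walk G u (as @ [y] @ cs) v"
      using less.prems unfolding xs
      by (auto simp: walk_def successively_append_iff successively_Cons hd_append split: if_splits)
    then show ?thesis using less.hyps[of "as @ [y] @ cs"] by (simp add: xs)
  qed (use less.prems in blast)
qed

text \<open>Acyclicity of a graph is refuted locally: it suffices to find, in a purported cycle, a vertex that
  can have only one neighbour on it.\<close>

lemma is_cycle_two_neighbours:
  assumes "is_cycle G xs" "x \<in> set xs"
  obtains y z where "y \<noteq> z" "y \<in> set xs" "z \<in> set xs" "{x, y} \<in> edges G" "{x, z} \<in> edges G"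
proof -
  define L where "L = length xs"
  have L: "3 \<le> L" and d: "distinct xs" and cl: "{xs ! (L - 1), xs ! 0} \<in> edges G"
    and st: "\<And>i. Suc i < L \<Longrightarrow> {xs ! i, xs ! Suc i} \<in> edges G"
    using assms(1)
    by (auto simp: is_cycle_def walk_def L_def last_conv_nth hd_conv_nth successively_conv_nth)
  obtain i where i: "i < L" "x = xs ! i" using assms(2) by (auto simp: in_set_conv_nth L_def)
  define j k where "j = (if i = L - 1 then 0 else Suc i)" and "k = (if i = 0 then L - 1 else i - 1)"
  have "j < L" "k < L" "j \<noteq> k" using i L by (auto simp: j_def k_def)
  then have "xs ! j \<noteq> xs ! k" "xs ! j \<in> set xs" "xs ! k \<in> set xs"
    using d by (auto simp: nth_eq_iff_index_eq L_def)
  moreover have "{x, xs ! j} \<in> edges G"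
    using i L cl st[of i] by (auto simp: j_def)
  moreover have "{x, xs ! k} \<in> edges G"
    using i L cl st[of "i - 1"] by (auto simp: k_def insert_commute)
  ultimately show ?thesis using that by blast
qed

text \<open>An orbit may leave \<open>r\<close> again after it has met \<open>r\<close>; this allows parent functions that are
  extensional on \<open>V - {r}\<close>.\<close>

definition rooted :: "'a set \<Rightarrow> 'a \<Rightarrow> ('a \<Rightarrow> 'a) \<Rightarrow> bool" where
  "rooted V r f \<longleftrightarrow> (\<forall>v\<in>V. \<exists>k. (f ^^ k) v = r)"

definition depth :: "'a \<Rightarrow> ('a \<Rightarrow> 'a) \<Rightarrow> 'a \<Rightarrow> nat" where
  "depth r f v = (LEAST k. (f ^^ k) v = r)"

definition parent_graph :: "'a set \<Rightarrow> 'a \<Rightarrow> ('a \<Rightarrow> 'a) \<Rightarrow> 'a graph" where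
  "parent_graph V r f = \<lparr>verts = V, edges = {{v, f v} |v. v \<in> V - {r}}\<rparr>"

lemma verts_parent_graph [simp]: "verts (parent_graph V r f) = V"
  by (simp add: parent_graph_def)

lemma depth_parent:
  assumes "rooted V r f" "v \<in> V - {r}"
  shows "depth r f v = Suc (depth r f (f v))"
proof -
  obtain k where "(f ^^ k) v = r" using assms by (auto simp: rooted_def)
  then have "depth r f v = Suc (LEAST k. (f ^^ Suc k) v = r)"
    unfolding depth_def using assms(2) by (intro Least_Suc) auto
  then show ?thesis by (simp add: depth_def funpow_swap1)
qed

lemma parent_edge_inj:
  assumes "rooted V r f" "u \<in> V - {r}" "v \<in> V - {r}" "{u, f u} = {v, f v}"
  shows "u = v"
  using depth_parent[OF assms(1,2)] depth_parent[OF assms(1,3)] assms(4)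
  by (auto simp: doubleton_eq_iff)

text \<open>Following the parents connects every vertex to the root. A vertex of maximal depth on a cycle would
  have two distinct neighbours that are not deeper, but its parent is the only such neighbour.\<close>

lemma is_tree_parent_graph:
  assumes "finite V" "r \<in> V" "f \<in> V - {r} \<rightarrow> V" "rooted V r f"
  shows "is_tree (parent_graph V r f)"
proof -
  let ?T = "parent_graph V r f"
  have neq: "v \<noteq> f v" if "v \<in> V - {r}" for v
    using depth_parent[OF assms(4) that] by auto
  have "simple_graph ?T"
    using assms(1,3) neq unfolding simple_graph_def parent_graph_def by fastforce
  moreover have to_root: "\<exists>xs. walk ?T v xs r" if "v \<in> V" for v
    using that
  proof (induction "depth r f v" arbitrary: v rule: less_induct)
    case less
    show ?case
    proof (cases "v = r")
      case True
      then show ?thesis using assms(2) by (intro exI[of _ "[r]"]) (simp add: walk_def parent_graph_def)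
    next
      case False
      then have v: "v \<in> V - {r}" using less.prems by simp
      then obtain xs where xs: "walk ?T (f v) xs r"
        using less.hyps[of "f v"] depth_parent[OF assms(4) v] assms(3) by auto
      then have "walk ?T v (v # xs) r"
        using v by (cases xs) (auto simp: walk_def parent_graph_def)
      then show ?thesis by blast
    qed
  qed
  have "graph_connected ?T"
    unfolding graph_connected_def
  proof (intro conjI ballI)
    fix u v assume "u \<in> verts ?T" "v \<in> verts ?T"
    then obtain xs ys where "walk ?T u xs r" "walk ?T v ys r"
      using to_root[of u] to_root[of v] by auto
    then show "\<exists>zs. walk ?T u zs v" using walk_append_tl walk_rev by metis
  qed (use assms(2) in \<open>auto simp: parent_graph_def\<close>)
  moreover have "\<not> is_cycle ?T xs" for xs
  proof
    assume c: "is_cycle ?T xs"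
    have sub: "set xs \<subseteq> V" and "xs \<noteq> []"
      using c by (auto simp: is_cycle_def walk_def parent_graph_def)
    define D where "D = Max (depth r f ` set xs)"
    have "D \<in> depth r f ` set xs" unfolding D_def using \<open>xs \<noteq> []\<close> by (intro Max_in) auto
    then obtain x where x: "x \<in> set xs" "depth r f x = D" by auto
    then have mx: "depth r f y \<le> depth r f x" if "y \<in> set xs" for y
      using that by (auto simp: D_def)
    have up: "y = f x" if y: "y \<in> set xs" and xy: "{x, y} \<in> edges ?T" for y
    proof -
      obtain v where v: "v \<in> V - {r}" "{x, y} = {v, f v}" using xy by (auto simp: parent_graph_def)
      then show ?thesis
        using depth_parent[OF assms(4) v(1)] mx[OF y] by (auto simp: doubleton_eq_iff)
    qed
    show False using is_cycle_two_neighbours[OF c x(1)] up by metis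
  qed
  ultimately show ?thesis by (simp add: is_tree_def)
qed

text \<open>A tree determines the parents by induction on the depth: if \<open>v\<close> had different parents under \<open>f\<close> and
  \<open>g\<close>, then the edge \<open>{v, f v}\<close> would have to come from \<open>g (f v) = v\<close>, whereas \<open>f\<close> and \<open>g\<close> agree at
  \<open>f v\<close>, which is closer to the root.\<close>

lemma parent_graph_inj:
  assumes f: "f \<in> extensional (V - {r})" "rooted V r f"
    and g: "g \<in> extensional (V - {r})" "rooted V r g"
    and eq: "parent_graph V r f = parent_graph V r g" and fV: "f \<in> V - {r} \<rightarrow> V"
  shows "f = g"
proof -
  have "f v = g v" if "v \<in> V - {r}" for v
    using that
  proof (induction "depth r f v" arbitrary: v rule: less_induct)
    case less
    have "{v, f v} \<in> edges (parent_graph V r g)"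
      using less.prems eq[symmetric] by (auto simp: parent_graph_def)
    then obtain w where w: "w \<in> V - {r}" "{v, f v} = {w, g w}" by (auto simp: parent_graph_def)
    show ?case
    proof (rule ccontr)
      assume "f v \<noteq> g v"
      then have "w = f v" "g w = v" using w(2) by (auto simp: doubleton_eq_iff)
      moreover have d: "depth r f v = Suc (depth r f (f v))"
        using depth_parent[OF f(2) less.prems] .
      ultimately have "f w = v" using less.hyps[of w] w(1) by auto
      then show False using d depth_parent[OF f(2) w(1)] \<open>w = f v\<close> by simp
    qed
  qed
  then show ?thesis using f(1) g(1) by (intro extensionalityI[of f "V - {r}" g]) auto
qed

text \<open>The parent of a vertex is a neighbour from which the root is reached by a shorter walk. The edges
  obtained in this way already connect all vertices, so any further edge would close a cycle.\<close>

lemma tree_is_parent_graph: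
  assumes T: "is_tree T" and r: "r \<in> verts T"
  obtains f where "f \<in> verts T - {r} \<rightarrow>\<^sub>E verts T" "rooted (verts T) r f" "parent_graph (verts T) r f = T"
proof -
  let ?V = "verts T"
  have simp: "simple_graph T" and conn: "graph_connected T" and acyc: "\<And>xs. \<not> is_cycle T xs"
    using T by (auto simp: is_tree_def)
  \<comment> \<open>The number of vertices, not of edges, of a shortest walk to the root.\<close>
  define len where "len v = (LEAST l. \<exists>xs. walk T v xs r \<and> length xs = l)" for v
  have "\<exists>u\<in>?V. {v, u} \<in> edges T \<and> len u < len v" if v: "v \<in> ?V - {r}" for v
  proof -
    have "\<exists>l xs. walk T v xs r \<and> length xs = l" using conn v r by (auto simp: graph_connected_def)
    then have "\<exists>xs. walk T v xs r \<and> length xs = len v" unfolding len_def by (rule LeastI_ex)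
    then obtain xs where xs: "walk T v xs r" "length xs = len v" by blast
    then obtain u ys where ys: "xs = v # u # ys" using v by (cases xs; cases "tl xs") (auto simp: walk_def)
    have w: "walk T u (u # ys) r" and "{v, u} \<in> edges T" using xs(1) by (auto simp: ys walk_Cons_Cons)
    moreover have "len u \<le> length (u # ys)" unfolding len_def using w by (intro Least_le) blast
    moreover have "u \<in> ?V" using w by (simp add: walk_def)
    ultimately show ?thesis using xs(2) by (auto simp: ys)
  qed
  then obtain g where g: "\<And>v. v \<in> ?V - {r} \<Longrightarrow> g v \<in> ?V \<and> {v, g v} \<in> edges T \<and> len (g v) < len v"
    by metis
  define f where "f = restrict g (?V - {r})"
  have f: "f \<in> ?V - {r} \<rightarrow>\<^sub>E ?V" and fE: "\<And>v. v \<in> ?V - {r} \<Longrightarrow> {v, f v} \<in> edges T \<and> len (f v) < len v"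
    using g by (auto simp: f_def)
  have "\<exists>k. (f ^^ k) v = r" if "v \<in> ?V" for v
    using that
  proof (induction "len v" arbitrary: v rule: less_induct)
    case less
    show ?case
    proof (cases "v = r")
      case True
      then show ?thesis by (intro exI[of _ 0]) simp
    next
      case False
      then obtain k where "(f ^^ k) (f v) = r" using less.hyps[of "f v"] fE[of v] less.prems f by auto
      then show ?thesis by (intro exI[of _ "Suc k"]) (simp add: funpow_swap1)
    qed
  qed
  then have root: "rooted ?V r f" by (simp add: rooted_def)
  let ?P = "parent_graph ?V r f"
  have sub: "edges ?P \<subseteq> edges T" using fE by (auto simp: parent_graph_def)
  have "edges T \<subseteq> edges ?P"
  proof
    fix e assume e: "e \<in> edges T"
    then obtain u v where uv: "u \<in> ?V" "v \<in> ?V" "u \<noteq> v" "e = {u, v}" using simp by (auto simp: simple_graph_def)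
    have "is_tree ?P" using simp r f root by (intro is_tree_parent_graph) (auto simp: simple_graph_def)
    then have "graph_connected ?P" by (simp add: is_tree_def)
    then have "\<exists>xs. walk ?P u xs v" using uv(1,2) by (simp add: graph_connected_def)
    then obtain xs where "walk ?P u xs v" ..
    from distinct_walk_exists[OF this] obtain ys where ys: "walk ?P u ys v" "distinct ys" by auto
    show "e \<in> edges ?P"
    proof (rule ccontr)
      assume ne: "e \<notin> edges ?P"
      have "3 \<le> length ys"
      proof (rule ccontr)
        assume "\<not> 3 \<le> length ys"
        then consider "ys = []" | x where "ys = [x]" | x y where "ys = [x, y]"
          by (cases ys; cases "tl ys"; cases "tl (tl ys)") auto
        then show False
          using ys(1) uv(3) ne unfolding uv(4) by cases (simp_all add: walk_def)
      qed
      moreover have "walk T u ys v"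
        using ys(1) sub successively_mono[of "\<lambda>x y. {x, y} \<in> edges ?P" ys "\<lambda>x y. {x, y} \<in> edges T"]
        unfolding walk_def by auto
      ultimately have "is_cycle T ys"
        using ys(2) e uv(4) by (auto simp: is_cycle_def walk_def insert_commute)
      then show False using acyc by blast
    qed
  qed
  then have "?P = T" using sub by (auto simp: parent_graph_def)
  then show ?thesis using that f root by blast
qed

lemma bij_betw_parent_graph:
  assumes "simple_graph G" "r \<in> verts G"
  shows "bij_betw (parent_graph (verts G) r)
    {f \<in> verts G - {r} \<rightarrow>\<^sub>E verts G. rooted (verts G) r f \<and> (\<forall>v\<in>verts G - {r}. {v, f v} \<in> edges G)}
    (spanning_trees G)"
proof (rule bij_betwI')
  fix f g
  assume "f \<in> {f \<in> verts G - {r} \<rightarrow>\<^sub>E verts G. rooted (verts G) r f \<and> (\<forall>v\<in>verts G - {r}. {v, f v} \<in> edges G)}"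
    "g \<in> {f \<in> verts G - {r} \<rightarrow>\<^sub>E verts G. rooted (verts G) r f \<and> (\<forall>v\<in>verts G - {r}. {v, f v} \<in> edges G)}"
  then show "parent_graph (verts G) r f = parent_graph (verts G) r g \<longleftrightarrow> f = g"
    using parent_graph_inj[of f "verts G" r g] by (auto simp: PiE_def)
next
  fix f
  assume "f \<in> {f \<in> verts G - {r} \<rightarrow>\<^sub>E verts G. rooted (verts G) r f \<and> (\<forall>v\<in>verts G - {r}. {v, f v} \<in> edges G)}"
  then show "parent_graph (verts G) r f \<in> spanning_trees G"
    using is_tree_parent_graph[of "verts G" r f] assms
    by (auto simp: spanning_trees_def simple_graph_def parent_graph_def)
next
  fix T assume T: "T \<in> spanning_trees G"
  then have "is_tree T" "verts T = verts G" "edges T \<subseteq> edges G" by (auto simp: spanning_trees_def)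
  moreover from this obtain f where
    f: "f \<in> verts G - {r} \<rightarrow>\<^sub>E verts G" "rooted (verts G) r f" "parent_graph (verts G) r f = T"
    using tree_is_parent_graph[of T r] assms(2) by auto
  moreover have "{v, f v} \<in> edges T" if "v \<in> verts G - {r}" for v
    using f(3) that by (auto simp: parent_graph_def)
  ultimately show "\<exists>f\<in>{f \<in> verts G - {r} \<rightarrow>\<^sub>E verts G. rooted (verts G) r f \<and>
      (\<forall>v\<in>verts G - {r}. {v, f v} \<in> edges G)}. T = parent_graph (verts G) r f"
    by (intro bexI[of _ f]) auto
qed

section \<open>The weighted matrix tree theorem\<close>

text \<open>The identity minus the matrix of \<open>f\<close>. There is no column for \<open>m\<close>, so a row whose vertex has the
  root \<open>m\<close> as its parent is a unit vector.\<close>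

definition parent_matrix :: "nat \<Rightarrow> (nat \<Rightarrow> nat) \<Rightarrow> 'a::idom mat" where
  "parent_matrix m f = mat m m (\<lambda>(i, j). of_bool (i = j) - of_bool (f i = j))"

text \<open>In the Leibniz formula a permutation \<open>p\<close> contributes only if \<open>p i\<close> is \<open>i\<close> or \<open>f i\<close> for all \<open>i\<close>. A
  nontrivial cycle of \<open>p\<close> would be a cycle of \<open>f\<close>, which does not exist if all vertices lead to the
  root. Thus only the identity contributes.\<close>

lemma det_parent_matrix_rooted:
  assumes "rooted {..m} m f"
  shows "det (parent_matrix m f) = (1 :: 'a::idom)"
proof -
  let ?P = "{p. p permutes {0..<m}}"
  let ?t = "\<lambda>p. signof p * (\<Prod>i = 0..<m. parent_matrix m f $$ (i, p i)) :: 'a"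
  have noloop: "f i \<noteq> i" if "i < m" for i
    using depth_parent[OF assms, of i] that by auto
  have "?t p = 0" if p: "p permutes {0..<m}" "p \<noteq> id" for p
  proof -
    obtain i where i: "p i \<noteq> i" using p(2) by (auto simp: fun_eq_iff)
    have lt: "p j < m \<longleftrightarrow> j < m" for j using permutes_in_image[OF p(1), of j] by simp
    have "i < m" using i p(1) by (auto simp: permutes_def)
    \<comment> \<open>Otherwise the orbit of \<open>i\<close> under \<open>p\<close> would follow the parent function and never meet the root.\<close>
    have "\<exists>j<m. p j \<noteq> j \<and> p j \<noteq> f j"
    proof (rule ccontr)
      assume "\<not> ?thesis"
      then have c: "\<And>j. j < m \<Longrightarrow> p j = j \<or> p j = f j" by blast
      have "(f ^^ k) i < m \<and> p ((f ^^ k) i) \<noteq> (f ^^ k) i" for k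
      proof (induction k)
        case (Suc k)
        let ?j = "(f ^^ k) i"
        have "p ?j = f ?j" using c[of ?j] Suc by auto
        moreover have "p (p ?j) \<noteq> p ?j" using Suc permutes_inj[OF p(1)] by (auto dest: injD)
        ultimately show ?case using Suc lt[of ?j] by auto
      qed (use i \<open>i < m\<close> in simp)
      moreover have "\<exists>k. (f ^^ k) i = m" using assms \<open>i < m\<close> by (simp add: rooted_def)
      ultimately show False by (metis less_irrefl)
    qed
    then obtain j where "j < m" "p j \<noteq> j" "p j \<noteq> f j" by blast
    then have "(\<Prod>i = 0..<m. parent_matrix m f $$ (i, p i)) = (0::'a)"
      using lt[of j] by (intro prod_zero bexI[of _ j]) (auto simp: parent_matrix_def)
    then show ?thesis by simp
  qed
  then have "sum ?t ?P = sum ?t {id}"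
    by (intro sum.mono_neutral_right) (auto simp: finite_permutations permutes_id)
  also have "\<dots> = 1"
    using noloop by (simp add: parent_matrix_def)
  finally show ?thesis
    by (subst det_def'[of _ m]) (simp_all add: parent_matrix_def)
qed

text \<open>The indicator vector of the set \<open>U\<close> of vertices that never reach the root lies in the kernel, as
  \<open>f i \<in> U\<close> holds exactly if \<open>i \<in> U\<close>.\<close>

lemma det_parent_matrix_unrooted:
  assumes f: "f \<in> {..<m} \<rightarrow> {..m}" and "\<not> rooted {..m} m f"
  shows "det (parent_matrix m f) = (0 :: 'a::idom)"
proof -
  let ?A = "parent_matrix m f :: 'a mat"
  define U where "U = {i. i \<le> m \<and> (\<forall>k. (f ^^ k) i \<noteq> m)}"
  have "U \<noteq> {}" using assms(2) by (auto simp: U_def rooted_def)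
  have "m \<notin> U" by (auto simp: U_def intro: exI[of _ 0])
  then have Um: "i < m" if "i \<in> U" for i using that by (cases "i = m") (auto simp: U_def)
  have step: "f i \<in> U \<longleftrightarrow> i \<in> U" if "i < m" for i
  proof -
    have "(\<exists>k. (f ^^ k) i = m) \<longleftrightarrow> (\<exists>k. (f ^^ Suc k) i = m)"
      using that by (metis funpow_0 nat_neq_iff not0_implies_Suc)
    then show ?thesis using f that by (auto simp: U_def funpow_swap1 PiE_def Pi_def)
  qed
  define v :: "'a vec" where "v = vec m (\<lambda>i. of_bool (i \<in> U))"
  have "?A *\<^sub>v v = 0\<^sub>v m"
  proof (rule eq_vecI)
    fix i assume "i < dim_vec (0\<^sub>v m :: 'a vec)"
    then have i: "i < m" by simp
    have "(?A *\<^sub>v v) $ i = (\<Sum>j = 0..<m. (of_bool (i = j) - of_bool (f i = j)) * of_bool (j \<in> U))"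
      using i by (simp add: parent_matrix_def v_def scalar_prod_def)
    also have "\<dots> = (\<Sum>j = 0..<m. if i = j then of_bool (j \<in> U) else 0)
        - (\<Sum>j = 0..<m. if f i = j then of_bool (j \<in> U) else 0)"
      unfolding sum_subtractf[symmetric] by (intro sum.cong) auto
    also have "\<dots> = of_bool (i \<in> U) - of_bool (f i \<in> U)"
      using i Um[of "f i"] by (auto simp: sum.delta')
    also have "\<dots> = 0" using step[OF i] by simp
    finally show "(?A *\<^sub>v v) $ i = 0\<^sub>v m $ i" using i by simp
  qed (simp add: parent_matrix_def)
  moreover have "v \<noteq> 0\<^sub>v m"
  proof
    obtain i where "i \<in> U" using \<open>U \<noteq> {}\<close> by blast
    moreover assume "v = 0\<^sub>v m"
    then have "v $ i = 0" using Um[OF \<open>i \<in> U\<close>] by simp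
    ultimately show False using Um[of i] by (simp add: v_def)
  qed
  ultimately show ?thesis
    by (intro iffD2[OF det_0_iff_vec_prod_zero[of ?A m]] exI[of _ v])
      (auto simp: parent_matrix_def v_def)
qed

definition reduced_laplacian :: "nat \<Rightarrow> (nat set \<Rightarrow> 'a::idom) \<Rightarrow> 'a mat" where
  "reduced_laplacian m w =
     mat m m (\<lambda>(i, j). if i = j then \<Sum>k\<in>{..m} - {i}. w {i, k} else - w {i, j})"

text \<open>Row \<open>i\<close> of the reduced Laplacian is the sum over \<open>k\<close> of \<open>w {i, k}\<close> times the difference of the
  unit vectors of \<open>i\<close> and \<open>k\<close>, where the unit vector of \<open>m\<close> is replaced by zero. Since the determinant is
  linear in each row, it is a sum over all choices of \<open>k = f i\<close>.\<close>

lemma det_reduced_laplacian_expansion: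
  assumes "\<And>i. w {i} = 0"
  shows "det (reduced_laplacian m w) =
    (\<Sum>f\<in>{..<m} \<rightarrow>\<^sub>E {..m}. (\<Prod>i<m. w {i, f i}) * det (parent_matrix m f))"
proof -
  let ?e = "\<lambda>i k j. of_bool (i = j) - of_bool (k = j) :: 'a"
  have entry: "reduced_laplacian m w $$ (i, j) = (\<Sum>k\<le>m. w {i, k} * ?e i k j)"
    if "i < m" "j < m" for i j
  proof (cases "i = j")
    case True
    have "(\<Sum>k\<le>m. w {i, k} * ?e i k j) = (\<Sum>k\<in>{..m} - {i}. w {i, k} * ?e i k j)"
      using that True by (subst sum.remove[of _ i]) (auto simp: assms)
    also have "\<dots> = (\<Sum>k\<in>{..m} - {i}. w {i, k})" using True by (intro sum.cong) auto
    finally show ?thesis using that True by (simp add: reduced_laplacian_def)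
  next
    case False
    have "(\<Sum>k\<le>m. w {i, k} * ?e i k j) = (\<Sum>k\<le>m. if j = k then - w {i, k} else 0)"
      using False by (intro sum.cong) auto
    then show ?thesis using that False by (simp add: reduced_laplacian_def)
  qed
  have "det (reduced_laplacian m w) = (\<Sum>p\<in>{p. p permutes {0..<m}}. signof p *
      (\<Prod>i = 0..<m. reduced_laplacian m w $$ (i, p i)))"
    by (intro det_def') (simp add: reduced_laplacian_def)
  also have "\<dots> = (\<Sum>p\<in>{p. p permutes {0..<m}}. signof p *
      (\<Sum>f\<in>{0..<m} \<rightarrow>\<^sub>E {..m}. \<Prod>i = 0..<m. w {i, f i} * ?e i (f i) (p i)))"
  proof (intro sum.cong refl arg_cong2[where f = "(*)"])
    fix p assume p: "p \<in> {p. p permutes {0..<m}}"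
    then have "p i < m" if "i < m" for i
      using that permutes_in_image[of p "{0..<m}" i] by auto
    then have "(\<Prod>i = 0..<m. reduced_laplacian m w $$ (i, p i)) =
        (\<Prod>i = 0..<m. \<Sum>k\<le>m. w {i, k} * ?e i k (p i))"
      by (intro prod.cong refl entry) auto
    also have "\<dots> = (\<Sum>f\<in>{0..<m} \<rightarrow>\<^sub>E {..m}. \<Prod>i = 0..<m. w {i, f i} * ?e i (f i) (p i))"
      by (rule prod_sum_PiE) auto
    finally show "(\<Prod>i = 0..<m. reduced_laplacian m w $$ (i, p i)) = \<dots>" .
  qed
  also have "\<dots> = (\<Sum>f\<in>{0..<m} \<rightarrow>\<^sub>E {..m}. \<Sum>p\<in>{p. p permutes {0..<m}}. signof p *
      (\<Prod>i = 0..<m. w {i, f i} * ?e i (f i) (p i)))"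
    by (simp add: sum_distrib_left) (rule sum.swap)
  also have "\<dots> = (\<Sum>f\<in>{0..<m} \<rightarrow>\<^sub>E {..m}. (\<Prod>i = 0..<m. w {i, f i}) * det (parent_matrix m f))"
  proof (intro sum.cong refl)
    fix f assume "f \<in> {0..<m} \<rightarrow>\<^sub>E {..m}"
    have "det (parent_matrix m f :: 'a mat) = (\<Sum>p\<in>{p. p permutes {0..<m}}. signof p *
        (\<Prod>i = 0..<m. parent_matrix m f $$ (i, p i)))"
      by (intro det_def') (simp add: parent_matrix_def)
    also have "\<dots> = (\<Sum>p\<in>{p. p permutes {0..<m}}. signof p * (\<Prod>i = 0..<m. ?e i (f i) (p i)))"
    proof (intro sum.cong refl arg_cong2[where f = "(*)"] prod.cong)
      fix p i assume "p \<in> {p. p permutes {0..<m}}" "i \<in> {0..<m}"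
      then have "i < m" "p i < m" using permutes_in_image[of p "{0..<m}" i] by auto
      then show "parent_matrix m f $$ (i, p i) = ?e i (f i) (p i)"
        by (simp add: parent_matrix_def)
    qed
    finally show "(\<Sum>p\<in>{p. p permutes {0..<m}}. signof p *
        (\<Prod>i = 0..<m. w {i, f i} * ?e i (f i) (p i)))
        = (\<Prod>i = 0..<m. w {i, f i}) * det (parent_matrix m f)"
      by (simp add: prod.distrib sum_distrib_left mult_ac)
  qed
  finally show ?thesis by (simp add: atLeast0LessThan)
qed

text \<open>Of the functions in the preceding expansion, exactly those survive that lead every vertex to the
  root along edges, and they correspond to the spanning trees. No two vertices have the same edge to
  their parents, so the weights multiply to the weight of the tree.\<close>

theorem weighted_matrix_tree:
  fixes w :: "nat set \<Rightarrow> 'a::idom"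
  assumes G: "simple_graph G" "verts G = {..m}" and w: "\<And>e. e \<notin> edges G \<Longrightarrow> w e = 0"
  shows "(\<Sum>T\<in>spanning_trees G. \<Prod>e\<in>edges T. w e) = det (reduced_laplacian m w)"
proof -
  let ?F = "{..<m} \<rightarrow>\<^sub>E {..m}" and ?R = "\<lambda>f. rooted {..m} m f"
  let ?B = "{f \<in> ?F. ?R f \<and> (\<forall>v<m. {v, f v} \<in> edges G)}"
  have fin: "finite ?F" by (intro finite_PiE) auto
  have "{i} \<notin> edges G" for i using G(1) by (auto simp: simple_graph_def)
  then have "det (reduced_laplacian m w) =
      (\<Sum>f\<in>?F. (\<Prod>i<m. w {i, f i}) * det (parent_matrix m f))"
    by (intro det_reduced_laplacian_expansion) (simp add: w)
  also have "\<dots> = (\<Sum>f\<in>?F. if ?R f then \<Prod>i<m. w {i, f i} else 0)"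
    using det_parent_matrix_rooted det_parent_matrix_unrooted[where 'a = 'a]
    by (intro sum.cong) (auto simp: PiE_def)
  also have "\<dots> = (\<Sum>f\<in>?B. if ?R f then \<Prod>i<m. w {i, f i} else 0)"
  proof (rule sum.mono_neutral_right[OF fin])
    show "\<forall>f\<in>?F - ?B. (if ?R f then \<Prod>i<m. w {i, f i} else 0) = 0"
      using w by (auto intro!: prod_zero)
  qed auto
  also have "\<dots> = (\<Sum>f\<in>?B. \<Prod>e\<in>edges (parent_graph {..m} m f). w e)"
  proof (intro sum.cong refl)
    fix f assume f: "f \<in> ?B"
    have "inj_on (\<lambda>i. {i, f i}) {..<m}"
      using f parent_edge_inj[of "{..m}" m f] by (intro inj_onI) auto
    moreover have "edges (parent_graph {..m} m f) = (\<lambda>i. {i, f i}) ` {..<m}"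
      by (auto simp: parent_graph_def)
    ultimately show "(if ?R f then \<Prod>i<m. w {i, f i} else 0) =
        (\<Prod>e\<in>edges (parent_graph {..m} m f). w e)"
      using f by (simp add: prod.reindex)
  qed
  also have "\<dots> = (\<Sum>T\<in>spanning_trees G. \<Prod>e\<in>edges T. w e)"
  proof (rule sum.reindex_bij_betw)
    have "{..m} - {m} = {..<m}" by auto
    then show "bij_betw (parent_graph {..m} m) ?B (spanning_trees G)"
      using bij_betw_parent_graph[OF G(1), of m] G(2) by (simp add: lessThan_def)
  qed
  finally show ?thesis ..
qed

section \<open>Adjacency in powers of cycles\<close>

lemma graph_dist_le_iff:
  "graph_dist G u v \<le> enat k \<longleftrightarrow> (\<exists>xs. walk G u xs v \<and> length xs \<le> Suc k)"
proof
  show "\<exists>xs. walk G u xs v \<and> length xs \<le> Suc k" if le: "graph_dist G u v \<le> enat k"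
  proof (rule ccontr)
    assume "\<not> ?thesis"
    then have "enat (Suc k) \<le> enat (length xs - 1)" if "walk G u xs v" for xs
      using that by (cases "length xs \<le> Suc k") auto
    then have "enat (Suc k) \<le> graph_dist G u v"
      unfolding graph_dist_def by (intro INF_greatest) auto
    from this le have "enat (Suc k) \<le> enat k" by (rule order_trans)
    then show False by simp
  qed
next
  assume "\<exists>xs. walk G u xs v \<and> length xs \<le> Suc k"
  then obtain xs where xs: "walk G u xs v" "length xs \<le> Suc k" by blast
  then have "graph_dist G u v \<le> enat (length xs - 1)"
    unfolding graph_dist_def by (intro INF_lower) simp
  also have "\<dots> \<le> enat k" using xs(2) by simp
  finally show "graph_dist G u v \<le> enat k" .
qed

lemma edge_graph_power_iff:
  "{u, v} \<in> edges (graph_power G k) \<longleftrightarrow>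
    u \<in> verts G \<and> v \<in> verts G \<and> u \<noteq> v \<and> (\<exists>xs. walk G u xs v \<and> length xs \<le> Suc k)"
proof -
  have ge1: "1 \<le> graph_dist G x y \<longleftrightarrow> x \<noteq> y" if "x \<in> verts G" for x y
  proof -
    have "graph_dist G x y \<le> enat 0 \<longleftrightarrow> x = y"
      unfolding graph_dist_le_iff
    proof
      show "x = y" if "\<exists>xs. walk G x xs y \<and> length xs \<le> Suc 0"
        using that by (auto simp: walk_def length_Suc_conv le_Suc_eq)
      show "\<exists>xs. walk G x xs y \<and> length xs \<le> Suc 0" if "x = y"
        using that \<open>x \<in> verts G\<close> by (intro exI[of _ "[x]"]) (simp add: walk_def)
    qed
    moreover have "1 \<le> graph_dist G x y \<longleftrightarrow> \<not> graph_dist G x y \<le> enat 0"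
      by (cases "graph_dist G x y") (auto simp: one_enat_def)
    ultimately show ?thesis by simp
  qed
  have sym: "(\<exists>xs. walk G x xs y \<and> length xs \<le> Suc k) \<longleftrightarrow> (\<exists>xs. walk G y xs x \<and> length xs \<le> Suc k)" for x y
    using walk_rev[of G x _ y] walk_rev[of G y _ x] by (metis length_rev)
  define P where "P x y \<longleftrightarrow> x \<in> verts G \<and> y \<in> verts G \<and> x \<noteq> y \<and>
    (\<exists>xs. walk G x xs y \<and> length xs \<le> Suc k)" for x y
  have "edges (graph_power G k) = {{x, y} |x y. P x y}"
    unfolding graph_power_def P_def using ge1 graph_dist_le_iff[of G _ _ k]
    by (simp cong: conj_cong)
  moreover have "P x y \<longleftrightarrow> P y x" for x y unfolding P_def using sym by blast
  ultimately have "{u, v} \<in> edges (graph_power G k) \<longleftrightarrow> P u v"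
    by (simp add: doubleton_eq_iff) blast
  then show ?thesis by (simp add: P_def)
qed

lemma edge_cycle_graph_iff:
  "{u, v} \<in> edges (cycle_graph n) \<longleftrightarrow>
    u < n \<and> v < n \<and> (int v = (int u + 1) mod int n \<or> int v = (int u - 1) mod int n)"
proof -
  have backwards: "int u = (int v + 1) mod int n \<longleftrightarrow> int v = (int u - 1) mod int n" if "u < n" "v < n" for u v
  proof
    assume "int u = (int v + 1) mod int n"
    then have "(int u - 1) mod int n = (int v + 1 - 1) mod int n" by (metis mod_diff_left_eq)
    then show "int v = (int u - 1) mod int n" using that by simp
  next
    assume "int v = (int u - 1) mod int n"
    then have "(int v + 1) mod int n = (int u - 1 + 1) mod int n" by (metis mod_add_left_eq)
    then show "int u = (int v + 1) mod int n" using that by simp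
  qed
  have succ: "w < n \<and> z = (w + 1) mod n \<longleftrightarrow> w < n \<and> z < n \<and> int z = (int w + 1) mod int n" for w z
  proof -
    have "int ((w + 1) mod n) = (int w + 1) mod int n" by (simp add: zmod_int add.commute)
    then have "z = (w + 1) mod n \<longleftrightarrow> int z = (int w + 1) mod int n" by (metis of_nat_eq_iff)
    then show ?thesis by auto
  qed
  have "{u, v} \<in> edges (cycle_graph n) \<longleftrightarrow>
      (u < n \<and> v = (u + 1) mod n) \<or> (v < n \<and> u = (v + 1) mod n)"
    by (auto simp: cycle_graph_def doubleton_eq_iff)
  also have "\<dots> \<longleftrightarrow> u < n \<and> v < n \<and> (int v = (int u + 1) mod int n \<or> int u = (int v + 1) mod int n)"
    using succ by auto
  also have "\<dots> \<longleftrightarrow> u < n \<and> v < n \<and> (int v = (int u + 1) mod int n \<or> int v = (int u - 1) mod int n)"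
    using backwards[of u v] by blast
  finally show ?thesis .
qed

text \<open>Walks are lifted from the cycle to the integers, where every step changes the position by \<open>1\<close> or \<open>-1\<close>.\<close>

lemma walk_cycle_graph_displacement:
  assumes "walk (cycle_graph n) u xs v"
  shows "\<exists>d. \<bar>d\<bar> < int (length xs) \<and> int v = (int u + d) mod int n"
  using assms
proof (induction xs arbitrary: u)
  case (Cons x xs)
  show ?case
  proof (cases xs)
    case Nil
    then show ?thesis using Cons.prems by (intro exI[of _ 0]) (simp add: walk_def cycle_graph_def)
  next
    case (Cons y ys)
    then have "u = x" and e: "{x, y} \<in> edges (cycle_graph n)" and "walk (cycle_graph n) y xs v"
      using Cons.prems by (simp_all add: walk_Cons_Cons)
    then obtain d where d: "\<bar>d\<bar> < int (length xs)" "int v = (int y + d) mod int n"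
      using Cons.IH by blast
    obtain c where c: "c = 1 \<or> c = -1" "int y = (int x + c) mod int n"
      using e unfolding edge_cycle_graph_iff by (metis uminus_add_conv_diff add.commute)
    have "int v = (int u + (c + d)) mod int n"
      using d(2) c(2) \<open>u = x\<close> by (simp add: mod_add_left_eq add.assoc)
    then show ?thesis using d(1) c(1) by (intro exI[of _ "c + d"]) auto
  qed
qed (simp add: walk_def)

lemma walk_cycle_graph_exists:
  assumes "u < n"
  shows "\<exists>xs. walk (cycle_graph n) u xs (nat ((int u + d) mod int n)) \<and> length xs = Suc (nat \<bar>d\<bar>)"
  using assms
proof (induction "nat \<bar>d\<bar>" arbitrary: u d)
  case 0
  then show ?case by (intro exI[of _ "[u]"]) (simp add: walk_def cycle_graph_def)
next
  case (Suc k)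
  define c where "c = sgn d"
  define y where "y = nat ((int u + c) mod int n)"
  have c: "c = 1 \<or> c = -1" using Suc.hyps(2) by (auto simp: c_def sgn_if)
  have y: "int y = (int u + c) mod int n" "y < n"
    using Suc.prems by (simp_all add: y_def nat_less_iff)
  have d': "k = nat \<bar>d - c\<bar>" using Suc.hyps(2) by (auto simp: c_def sgn_if)
  obtain xs where xs: "walk (cycle_graph n) y xs (nat ((int y + (d - c)) mod int n))"
    "length xs = Suc (nat \<bar>d - c\<bar>)"
    using Suc.hyps(1)[OF d' y(2)] by blast
  have "(int y + (d - c)) mod int n = (int u + d) mod int n"
    unfolding y(1) by (simp add: mod_add_left_eq)
  moreover have "{u, y} \<in> edges (cycle_graph n)"
    using c y Suc.prems by (auto simp: edge_cycle_graph_iff)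
  ultimately have "walk (cycle_graph n) u (u # xs) (nat ((int u + d) mod int n))"
    using xs(1) Suc.prems by (cases xs) (auto simp: walk_def cycle_graph_def)
  then show ?case using xs(2) d' Suc.hyps(2) by (intro exI[of _ "u # xs"]) simp
qed

lemma edge_cycle_power_iff:
  "{u, v} \<in> edges (graph_power (cycle_graph n) k) \<longleftrightarrow>
    u < n \<and> v < n \<and> u \<noteq> v \<and> (\<exists>d. \<bar>d\<bar> \<le> int k \<and> int v = (int u + d) mod int n)"
proof -
  have "(\<exists>xs. walk (cycle_graph n) u xs v \<and> length xs \<le> Suc k) \<longleftrightarrow>
      (\<exists>d. \<bar>d\<bar> \<le> int k \<and> int v = (int u + d) mod int n)" (is "?L \<longleftrightarrow> ?R") if "u < n"
  proof
    assume ?L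
    then obtain xs where xs: "walk (cycle_graph n) u xs v" "length xs \<le> Suc k" by blast
    obtain d where "\<bar>d\<bar> < int (length xs)" "int v = (int u + d) mod int n"
      using walk_cycle_graph_displacement[OF xs(1)] by blast
    then show ?R using xs(2) by (intro exI[of _ d]) auto
  next
    assume ?R
    then obtain d where d: "\<bar>d\<bar> \<le> int k" "int v = (int u + d) mod int n" by blast
    then show ?L using walk_cycle_graph_exists[OF that, of d]
      by (metis Suc_le_mono nat_int nat_le_iff)
  qed
  then show ?thesis by (auto simp: edge_graph_power_iff cycle_graph_def)
qed

section \<open>Automorphisms and the number of leaves\<close>

definition map_graph :: "('a \<Rightarrow> 'b) \<Rightarrow> 'a graph \<Rightarrow> 'b graph" where
  "map_graph f G = \<lparr>verts = f ` verts G, edges = (`) f ` edges G\<rparr>"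

lemma walk_map_graph: "walk G u xs v \<Longrightarrow> walk (map_graph f G) (f u) (map f xs) (f v)"
  unfolding walk_def map_graph_def
  by (auto simp: hd_map last_map successively_map image_iff
      elim!: successively_mono intro!: bexI[of _ "{_, _}"])

lemma map_graph_inverse:
  assumes "simple_graph G" "\<And>v. v \<in> verts G \<Longrightarrow> g (f v) = v"
  shows "map_graph g (map_graph f G) = G"
proof -
  have "g ` f ` e = e" if "e \<in> edges G" for e
    using assms that unfolding simple_graph_def by fastforce
  then have "(`) g ` (`) f ` edges G = edges G" by (simp add: image_image)
  moreover have "g ` f ` verts G = verts G" using assms(2) by (simp add: image_image)
  ultimately show ?thesis by (simp add: map_graph_def)
qed

lemma simple_graph_map_graph:
  assumes "simple_graph G" "inj_on f (verts G)"
  shows "simple_graph (map_graph f G)"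
  unfolding simple_graph_def
proof (intro conjI ballI)
  fix e assume "e \<in> edges (map_graph f G)"
  then obtain u v where "u \<in> verts G" "v \<in> verts G" "u \<noteq> v" "e = {f u, f v}"
    using assms(1) by (fastforce simp: map_graph_def simple_graph_def)
  then show "\<exists>u\<in>verts (map_graph f G). \<exists>v\<in>verts (map_graph f G). u \<noteq> v \<and> e = {u, v}"
    using assms(2) by (auto simp: map_graph_def dest: inj_onD)
qed (use assms(1) in \<open>simp add: map_graph_def simple_graph_def\<close>)

lemma is_cycle_map_graph:
  assumes "is_cycle G xs" "inj_on f (verts G)"
  shows "is_cycle (map_graph f G) (map f xs)"
proof -
  have xs: "walk G (hd xs) xs (last xs)" "xs \<noteq> []" "set xs \<subseteq> verts G" "{last xs, hd xs} \<in> edges G"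
    using assms(1) by (auto simp: is_cycle_def walk_def)
  have "f ` {last xs, hd xs} \<in> edges (map_graph f G)"
    using imageI[OF xs(4), of "(`) f"] by (simp add: map_graph_def)
  then show ?thesis
    using assms(1) walk_map_graph[OF xs(1), of f] xs inj_on_subset[OF assms(2) xs(3)]
    by (simp add: is_cycle_def hd_map last_map distinct_map)
qed

lemma is_tree_map_graph:
  assumes "is_tree T" "inj_on f (verts T)"
  shows "is_tree (map_graph f T)"
  unfolding is_tree_def
proof (intro conjI)
  have T: "simple_graph T" "graph_connected T" using assms(1) by (auto simp: is_tree_def)
  show simp: "simple_graph (map_graph f T)" using simple_graph_map_graph[OF T(1) assms(2)] .
  show "graph_connected (map_graph f T)"
    unfolding graph_connected_def
  proof (intro conjI ballI)
    fix u v assume "u \<in> verts (map_graph f T)" "v \<in> verts (map_graph f T)"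
    then obtain x y where "x \<in> verts T" "y \<in> verts T" and uv: "u = f x" "v = f y"
      by (auto simp: map_graph_def)
    then have "\<exists>xs. walk T x xs y" using T(2) by (simp add: graph_connected_def)
    then show "\<exists>xs. walk (map_graph f T) u xs v" unfolding uv using walk_map_graph[of T x _ y f] by auto
  qed (use T(2) in \<open>simp add: graph_connected_def map_graph_def\<close>)
  show "\<nexists>xs. is_cycle (map_graph f T) xs"
  proof
    assume "\<exists>xs. is_cycle (map_graph f T) xs"
    then obtain xs where xs: "is_cycle (map_graph f T) xs" ..
    let ?g = "inv_into (verts T) f"
    have "is_cycle (map_graph ?g (map_graph f T)) (map ?g xs)"
      by (intro is_cycle_map_graph[OF xs]) (simp add: map_graph_def inj_on_inv_into)
    moreover have "map_graph ?g (map_graph f T) = T"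
      using T(1) assms(2) by (intro map_graph_inverse) simp_all
    ultimately show False using assms(1) by (simp add: is_tree_def)
  qed
qed

lemma degree_map_graph:
  assumes "simple_graph G" "inj_on f (verts G)" "v \<in> verts G"
  shows "Defs.degree (map_graph f G) (f v) = Defs.degree G v"
proof -
  have sub: "e \<subseteq> verts G" if "e \<in> edges G" for e
    using assms(1) that by (fastforce simp: simple_graph_def)
  have "{e \<in> edges (map_graph f G). Q e} = (`) f ` {e \<in> edges G. Q (f ` e)}" for Q
    by (auto simp: map_graph_def)
  moreover have "f v \<in> f ` e \<longleftrightarrow> v \<in> e" if "e \<in> edges G" for e
    using inj_on_image_mem_iff[OF assms(2,3) sub[OF that]] .
  ultimately have "{e \<in> edges (map_graph f G). f v \<in> e} = (`) f ` {e \<in> edges G. v \<in> e}"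
    by (simp cong: conj_cong)
  moreover have "inj_on ((`) f) {e \<in> edges G. v \<in> e}"
    using sub by (intro inj_on_subset[OF inj_on_image_Pow[OF assms(2)]]) auto
  ultimately show ?thesis by (simp add: Defs.degree_def card_image)
qed

text \<open>An automorphism maps spanning trees to spanning trees injectively. One inequality is enough, since
  for rotations the other one comes from the inverse rotation.\<close>

lemma card_trees_with_leaf_mono:
  assumes G: "simple_graph G" and f: "bij_betw f (verts G) (verts G)"
    and hom: "\<And>u v. {u, v} \<in> edges G \<Longrightarrow> {f u, f v} \<in> edges G" and v: "v \<in> verts G"
  shows "card {T \<in> spanning_trees G. v \<in> leaves T} \<le> card {T \<in> spanning_trees G. f v \<in> leaves T}"
proof (rule card_inj_on_le)
  have inj: "inj_on f (verts G)" and im: "f ` verts G = verts G"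
    using f by (auto simp: bij_betw_def)
  have tree: "is_tree T" "simple_graph T" "verts T = verts G" "edges T \<subseteq> edges G"
    if "T \<in> spanning_trees G" for T
    using that by (auto simp: spanning_trees_def is_tree_def)
  show "map_graph f ` {T \<in> spanning_trees G. v \<in> leaves T} \<subseteq> {T \<in> spanning_trees G. f v \<in> leaves T}"
  proof safe
    fix T assume T: "T \<in> spanning_trees G" and l: "v \<in> leaves T"
    note t = tree[OF T]
    have "edges (map_graph f T) \<subseteq> edges G"
    proof
      fix e assume "e \<in> edges (map_graph f T)"
      then obtain e' where e': "e' \<in> edges T" "e = f ` e'" by (auto simp: map_graph_def)
      then obtain x y where "e' = {x, y}" using t(2) by (auto simp: simple_graph_def)
      then show "e \<in> edges G" using e' t(4) hom[of x y] by auto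
    qed
    then show "map_graph f T \<in> spanning_trees G"
      using is_tree_map_graph[OF t(1), of f] inj im t(3)
      by (auto simp: spanning_trees_def map_graph_def)
    show "f v \<in> leaves (map_graph f T)"
      using l degree_map_graph[OF t(2), of f v] inj t(3) by (auto simp: leaves_def map_graph_def)
  qed
  show "inj_on (map_graph f) {T \<in> spanning_trees G. v \<in> leaves T}"
  proof (rule inj_on_inverseI)
    fix T assume "T \<in> {T \<in> spanning_trees G. v \<in> leaves T}"
    then have "simple_graph T" "verts T = verts G" using tree by auto
    then show "map_graph (inv_into (verts G) f) (map_graph f T) = T"
      using inj by (intro map_graph_inverse) simp_all
  qed
  show "finite {T \<in> spanning_trees G. f v \<in> leaves T}"
    using finite_spanning_trees[OF G] by simp
qed

lemma sum_card_leaves: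
  assumes "simple_graph G"
  shows "(\<Sum>T\<in>spanning_trees G. card (leaves T)) =
    (\<Sum>v\<in>verts G. card {T \<in> spanning_trees G. v \<in> leaves T})"
proof -
  have fin: "finite (verts G)" "finite (spanning_trees G)"
    using assms finite_spanning_trees by (auto simp: simple_graph_def)
  have "leaves T = {v \<in> verts G. v \<in> leaves T}" if "T \<in> spanning_trees G" for T
    using that by (auto simp: spanning_trees_def leaves_def)
  then have "(\<Sum>T\<in>spanning_trees G. card (leaves T)) =
      (\<Sum>T\<in>spanning_trees G. card {v \<in> verts G. v \<in> leaves T})" by simp
  also have "\<dots> = (\<Sum>v\<in>verts G. card {T \<in> spanning_trees G. v \<in> leaves T})"
    using sum.swap_restrict[OF fin(2,1), of "\<lambda>_ _. 1::nat" "\<lambda>T v. v \<in> leaves T"] by simp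
  finally show ?thesis .
qed

lemma card_trees_with_leaf_cycle_power:
  fixes n k u v :: nat
  assumes n: "3 \<le> n" and "u < n" "v < n"
  defines "G \<equiv> graph_power (cycle_graph n) k"
  shows "card {T \<in> spanning_trees G. u \<in> leaves T} = card {T \<in> spanning_trees G. v \<in> leaves T}"
proof -
  have G: "simple_graph G" "verts G = {..<n}"
    using simple_graph_graph_power[OF simple_graph_cycle_graph[OF n]]
    by (auto simp: G_def graph_power_def cycle_graph_def)
  have "card {T \<in> spanning_trees G. u \<in> leaves T} \<le> card {T \<in> spanning_trees G. v \<in> leaves T}"
    if uv: "u < n" "v < n" for u v
  proof -
    define f where "f x = nat ((int x + (int v - int u)) mod int n)" for x
    have int_f: "int (f x) = (int x + (int v - int u)) mod int n" for x
      using n by (simp add: f_def)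
    have f_less: "f x < n" for x using n by (simp add: f_def nat_less_iff)
    have inj: "inj_on f {..<n}"
    proof (rule inj_onI)
      fix x y assume xy: "x \<in> {..<n}" "y \<in> {..<n}" "f x = f y"
      then have "(int x + (int v - int u)) mod int n = (int y + (int v - int u)) mod int n"
        using int_f by metis
      then have "(int x + (int v - int u) - (int v - int u)) mod int n =
          (int y + (int v - int u) - (int v - int u)) mod int n" by (metis mod_diff_left_eq)
      then show "x = y" using xy by simp
    qed
    have "bij_betw f (verts G) (verts G)"
      unfolding G(2) by (intro bij_betw_imageI inj endo_inj_surj) (use inj f_less in auto)
    moreover have "{f x, f y} \<in> edges G" if xy: "{x, y} \<in> edges G" for x y
    proof -
      obtain d where d: "x < n" "y < n" "x \<noteq> y" "\<bar>d\<bar> \<le> int k" "int y = (int x + d) mod int n"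
        using xy by (auto simp: G_def edge_cycle_power_iff)
      have "int (f y) = (int (f x) + d) mod int n"
        unfolding int_f d(5) by (simp only: mod_add_left_eq) (simp add: algebra_simps)
      then show ?thesis
        using d f_less inj by (auto simp: G_def edge_cycle_power_iff dest: inj_onD)
    qed
    moreover have "f u = v" using uv by (simp add: f_def)
    ultimately show ?thesis using card_trees_with_leaf_mono[OF G(1), of f u] uv G(2) by simp
  qed
  then show ?thesis using assms(2,3) by (simp add: antisym)
qed

lemma BZ_seq_cycle_power:
  fixes n k v :: nat
  assumes n: "3 \<le> n" and "v < n"
  defines "G \<equiv> graph_power (cycle_graph n) k"
  shows "BZ_seq (\<lambda>n. graph_power (cycle_graph n) k) n =
    real (card {T \<in> spanning_trees G. v \<in> leaves T}) / real (num_spanning_trees G)"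
proof -
  have G: "simple_graph G" "verts G = {..<n}"
    using simple_graph_graph_power[OF simple_graph_cycle_graph[OF n]]
    by (auto simp: G_def graph_power_def cycle_graph_def)
  have "(\<Sum>T\<in>spanning_trees G. card (leaves T)) =
      (\<Sum>u<n. card {T \<in> spanning_trees G. v \<in> leaves T})"
    unfolding sum_card_leaves[OF G(1)] G(2) unfolding G_def
    using card_trees_with_leaf_cycle_power[OF n _ \<open>v < n\<close>] by (intro sum.cong) auto
  then show ?thesis
    using n unfolding BZ_seq_def G_def[symmetric] by simp
qed

section \<open>Counting the trees in which a vertex is a leaf\<close>

text \<open>The generating function of the degree at one vertex, obtained by marking its edges with \<open>s\<close>.\<close>

lemma edge_weighted_tree_sum_vertex:
  fixes s :: "'a::idom"
  assumes G: "simple_graph G" "verts G = {..m}"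
  shows "(\<Sum>T\<in>spanning_trees G. s ^ Defs.degree T m) =
    det (reduced_laplacian m (\<lambda>e. if e \<in> edges G then if m \<in> e then s else 1 else 0))"
    (is "_ = det (reduced_laplacian m ?w)")
proof -
  have "(\<Prod>e\<in>edges T. ?w e) = s ^ Defs.degree T m" if T: "T \<in> spanning_trees G" for T
  proof -
    have "edges T \<subseteq> edges G" using T by (simp add: spanning_trees_def)
    moreover have "finite (edges G)"
      using G(1) by (intro finite_subset[of "edges G" "Pow (verts G)"]) (auto simp: simple_graph_def)
    ultimately have fin: "finite (edges T)" by (rule finite_subset)
    have "(\<Prod>e\<in>edges T. ?w e) = (\<Prod>e\<in>edges T. if m \<in> e then s else 1)"
      using \<open>edges T \<subseteq> edges G\<close> by (intro prod.cong) auto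
    also have "\<dots> = (\<Prod>e\<in>{e \<in> edges T. m \<in> e}. s)"
      by (simp add: prod.inter_filter[OF fin] flip: prod_constant)
    finally show ?thesis by (simp add: Defs.degree_def)
  qed
  then show ?thesis using weighted_matrix_tree[OF G, of ?w] by simp
qed

text \<open>Only exponent \<open>1\<close> contributes to the derivative at \<open>0\<close>; applied to degrees, this picks out the trees
  in which a vertex is a leaf.\<close>

lemma has_real_derivative_sum_power_at_0:
  assumes "finite A"
  shows "((\<lambda>s. \<Sum>x\<in>A. s ^ f x) has_real_derivative real (card {x \<in> A. f x = 1})) (at 0)"
proof -
  have "((\<lambda>s. \<Sum>x\<in>A. s ^ f x) has_real_derivative (\<Sum>x\<in>A. real (f x) * 0 ^ (f x - 1))) (at 0)"
    by (auto intro!: derivative_eq_intros)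
  also have "(\<Sum>x\<in>A. real (f x) * 0 ^ (f x - 1)) = (\<Sum>x\<in>A. if f x = 1 then 1 else 0)"
    by (intro sum.cong) (auto simp: power_0_left)
  also have "\<dots> = real (card {x \<in> A. f x = 1})"
    using assms by (simp add: sum.inter_filter[symmetric])
  finally show ?thesis .
qed

section \<open>Determinants of low-rank perturbations\<close>

text \<open>Both sides are the determinant of the block matrix with diagonal blocks \<open>I\<close> and off-diagonal blocks
  \<open>X\<close> and \<open>Y\<close>, from which either \<open>Y\<close> or \<open>X\<close> is eliminated. For small \<open>k\<close> this turns a determinant whose size grows into one of
  fixed size.\<close>

lemma det_one_minus_mult_commute:
  fixes X Y :: "'a::idom mat"
  assumes X: "X \<in> carrier_mat m k" and Y: "Y \<in> carrier_mat k m"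
  shows "det (1\<^sub>m m - X * Y) = det (1\<^sub>m k - Y * X)"
proof -
  let ?L = "four_block_mat (1\<^sub>m m) (0\<^sub>m m k) Y (1\<^sub>m k)"
  let ?U = "four_block_mat (1\<^sub>m m - X * Y) X (0\<^sub>m k m) (1\<^sub>m k)"
  let ?V = "four_block_mat (1\<^sub>m m) X (0\<^sub>m k m) (1\<^sub>m k - Y * X)"
  have XY: "X * Y \<in> carrier_mat m m" "1\<^sub>m m - X * Y \<in> carrier_mat m m"
    and YX: "Y * X \<in> carrier_mat k k" "1\<^sub>m k - Y * X \<in> carrier_mat k k" using X Y by auto
  have car: "?L \<in> carrier_mat (m + k) (m + k)" "?U \<in> carrier_mat (m + k) (m + k)"
    "?V \<in> carrier_mat (m + k) (m + k)" using X Y XY YX by auto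
  have cancel: "1\<^sub>m m - X * Y + X * Y = 1\<^sub>m m" "Y * X + (1\<^sub>m k - Y * X) = 1\<^sub>m k"
    using X Y by (auto intro!: eq_matI)
  have "?U * ?L = four_block_mat (1\<^sub>m m) X Y (1\<^sub>m k)"
    by (subst mult_four_block_mat[of _ m m _ k _ k _ _ m _ k])
      (use X Y XY cancel in \<open>simp_all add: left_add_zero_mat right_add_zero_mat right_mult_zero_mat left_mult_zero_mat\<close>)
  moreover have "?L * ?V = four_block_mat (1\<^sub>m m) X Y (1\<^sub>m k)"
    by (subst mult_four_block_mat[of _ m m _ k _ k _ _ m _ k])
      (use X Y YX cancel in \<open>simp_all add: left_add_zero_mat right_add_zero_mat right_mult_zero_mat left_mult_zero_mat\<close>)
  ultimately have "det ?U * det ?L = det ?L * det ?V"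
    using det_mult[OF car(2,1)] det_mult[OF car(1,3)] by simp
  moreover have "det ?L = 1"
    using Y by (simp add: det_four_block_mat_upper_right_zero[of _ m _ k])
  moreover have "det ?U = det (1\<^sub>m m - X * Y)"
    using X XY by (simp add: det_four_block_mat_lower_left_zero[of _ m _ k])
  moreover have "det ?V = det (1\<^sub>m k - Y * X)"
    using X YX by (simp add: det_four_block_mat_lower_left_zero[of _ m _ k])
  ultimately show ?thesis by simp
qed

text \<open>The matrix commutes with the exchange of the two blocks, so it preserves the symmetric and the
  antisymmetric vectors, on which it acts as \<open>P + Q\<close> and \<open>P - Q\<close>.\<close>

lemma det_symmetric_block_mat:
  fixes P Q :: "'a::idom mat"
  assumes P: "P \<in> carrier_mat k k" and Q: "Q \<in> carrier_mat k k"
  shows "det (four_block_mat P Q Q P) = det (P + Q) * det (P - Q)"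
proof -
  let ?A = "four_block_mat P Q Q P"
  let ?L = "four_block_mat (1\<^sub>m k) (0\<^sub>m k k) (1\<^sub>m k) (1\<^sub>m k) :: 'a mat"
  let ?K = "four_block_mat (1\<^sub>m k) (0\<^sub>m k k) (- 1\<^sub>m k) (1\<^sub>m k) :: 'a mat"
  let ?B = "four_block_mat (P + Q) Q (0\<^sub>m k k) (P - Q)"
  have car: "?A \<in> carrier_mat (k + k) (k + k)" "?L \<in> carrier_mat (k + k) (k + k)"
    "?K \<in> carrier_mat (k + k) (k + k)" using P Q by auto
  have AL: "?A * ?L = four_block_mat (P + Q) Q (Q + P) P"
    by (subst mult_four_block_mat[of _ k k _ k _ k _ _ k _ k])
      (use P Q in \<open>simp_all add: left_add_zero_mat right_mult_zero_mat\<close>)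
  have neg: "- 1\<^sub>m k * Q = - Q" "- 1\<^sub>m k * (P + Q) = - (P + Q)" using P Q by simp_all
  have "?K * (?A * ?L) = ?B"
    unfolding AL
    by (subst mult_four_block_mat[of _ k k _ k _ k _ _ k _ k])
      (use P Q neg in \<open>auto intro!: eq_matI arg_cong2[where f = "\<lambda>X. four_block_mat (P + Q) Q X"] simp: left_add_zero_mat\<close>)
  then have "det ?B = det ?K * (det ?A * det ?L)"
    using det_mult[OF car(3) mult_carrier_mat[OF car(1,2)]] det_mult[OF car(1,2)] by simp
  moreover have "det ?L = 1" "det ?K = 1"
    by (simp_all add: det_four_block_mat_upper_right_zero[of _ k _ k])
  moreover have "det ?B = det (P + Q) * det (P - Q)"
    using P Q by (intro det_four_block_mat_lower_left_zero[of _ k _ k]) auto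
  ultimately show ?thesis by simp
qed

text \<open>With \<open>minors3\<close> and \<open>det3\<close>, the coefficients up to sign of the characteristic polynomial of a matrix of size \<open>3\<close>.\<close>

definition trace3 :: "(nat \<Rightarrow> nat \<Rightarrow> 'a::comm_ring_1) \<Rightarrow> 'a" where
  "trace3 R = R 0 0 + R 1 1 + R 2 2"

definition minors3 :: "(nat \<Rightarrow> nat \<Rightarrow> 'a::comm_ring_1) \<Rightarrow> 'a" where
  "minors3 R = (R 0 0 * R 1 1 - R 0 1 * R 1 0) + (R 0 0 * R 2 2 - R 0 2 * R 2 0)
    + (R 1 1 * R 2 2 - R 1 2 * R 2 1)"

definition det3 :: "(nat \<Rightarrow> nat \<Rightarrow> 'a::comm_ring_1) \<Rightarrow> 'a" where
  "det3 R = R 0 0 * (R 1 1 * R 2 2 - R 1 2 * R 2 1) - R 0 1 * (R 1 0 * R 2 2 - R 1 2 * R 2 0)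
    + R 0 2 * (R 1 0 * R 2 1 - R 1 1 * R 2 0)"

lemma det_mat_2: "det (mat 2 2 f) = f (0, 0) * f (1, 1) - f (0, 1) * f (1, 0)"
  for f :: "nat \<times> nat \<Rightarrow> 'a::idom"
  by (subst laplace_expansion_row[of _ 2 0])
    (simp_all add: cofactor_def mat_delete_def numeral_2_eq_2 lessThan_Suc det_single)

lemma det_mat_3: "det (mat 3 3 f) = det3 (\<lambda>i j. f (i, j))"
  for f :: "nat \<times> nat \<Rightarrow> 'a::idom"
proof -
  have d: "mat_delete (mat 3 3 f) 0 j = mat 2 2 (\<lambda>(i, k). f (Suc i, if k < j then k else Suc k))" for j
    by (intro eq_matI) (auto simp: mat_delete_def)
  have "det (mat 3 3 f) = (\<Sum>j<3. mat 3 3 f $$ (0, j) * cofactor (mat 3 3 f) 0 j)"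
    by (rule laplace_expansion_row) auto
  also have "\<dots> = (\<Sum>j\<in>{0, 1, 2}. f (0, j) * ((- 1) ^ j *
      det (mat 2 2 (\<lambda>(i, k). f (Suc i, if k < j then k else Suc k)))))"
  proof (rule sum.cong)
    fix j :: nat assume "j \<in> {0, 1, 2}"
    then show "mat 3 3 f $$ (0, j) * cofactor (mat 3 3 f) 0 j = f (0, j) * ((- 1) ^ j *
      det (mat 2 2 (\<lambda>(i, k). f (Suc i, if k < j then k else Suc k))))"
      unfolding cofactor_def d by auto
  qed auto
  also have "\<dots> = det3 (\<lambda>i j. f (i, j))"
    unfolding det_mat_2 by (simp add: det3_def numeral_2_eq_2 algebra_simps)
  finally show ?thesis .
qed

lemma det_one_minus_smult_3:
  fixes R :: "nat \<Rightarrow> nat \<Rightarrow> 'a::idom"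
  shows "det (mat 3 3 (\<lambda>(i, j). of_bool (i = j) - t * R i j)) =
    1 - t * trace3 R + t ^ 2 * minors3 R - t ^ 3 * det3 R"
  unfolding det_mat_3 det3_def trace3_def minors3_def
  by (simp add: power2_eq_square power3_eq_cube algebra_simps)

section \<open>The Laplacian of the third power of a cycle\<close>

definition third_cycle_power :: "nat \<Rightarrow> nat graph" where
  "third_cycle_power n = graph_power (cycle_graph n) 3"

definition hops :: "int set" where
  "hops = {-3, -2, -1, 1, 2, 3}"

lemma simple_third_cycle_power: "3 \<le> n \<Longrightarrow> simple_graph (third_cycle_power n)"
  by (simp add: third_cycle_power_def simple_graph_graph_power simple_graph_cycle_graph)

lemma verts_third_cycle_power: "verts (third_cycle_power n) = {..<n}"
  by (simp add: third_cycle_power_def graph_power_def cycle_graph_def)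

lemma not_dvd_hop:
  assumes "7 \<le> n" "d \<in> hops"
  shows "\<not> int n dvd d"
  using assms zdvd_not_zless[of "\<bar>d\<bar>" "int n"] by (auto simp: hops_def)

lemma edge_third_cycle_power_iff:
  assumes "7 \<le> n"
  shows "{u, v} \<in> edges (third_cycle_power n) \<longleftrightarrow>
    u < n \<and> (\<exists>d\<in>hops. v = nat ((int u + d) mod int n))"
proof
  assume "{u, v} \<in> edges (third_cycle_power n)"
  then have uv: "u < n" "v < n" "u \<noteq> v" and "\<exists>d. \<bar>d\<bar> \<le> int 3 \<and> int v = (int u + d) mod int n"
    unfolding third_cycle_power_def edge_cycle_power_iff by blast+
  then obtain d where d: "\<bar>d\<bar> \<le> 3" "int v = (int u + d) mod int n" by auto
  have "d \<noteq> 0" using uv d(2) by (intro notI) simp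
  then have "d \<in> hops" using d(1) by (auto simp: hops_def)
  moreover have "v = nat ((int u + d) mod int n)" using d(2) by (metis nat_int)
  ultimately show "u < n \<and> (\<exists>d\<in>hops. v = nat ((int u + d) mod int n))" using uv(1) by blast
next
  assume "u < n \<and> (\<exists>d\<in>hops. v = nat ((int u + d) mod int n))"
  then obtain d where d: "u < n" "d \<in> hops" "v = nat ((int u + d) mod int n)" by blast
  have v: "int v = (int u + d) mod int n" "v < n" using d assms by (simp_all add: nat_less_iff)
  have "u \<noteq> v"
  proof
    assume "u = v"
    then have "(int u + d) mod int n = int u mod int n" using v by simp
    then have "int n dvd d" by (simp add: mod_eq_dvd_iff)
    then show False using not_dvd_hop[OF assms d(2)] by simp
  qed
  moreover have "\<bar>d\<bar> \<le> int 3" using d(2) by (auto simp: hops_def)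
  ultimately show "{u, v} \<in> edges (third_cycle_power n)"
    unfolding third_cycle_power_def edge_cycle_power_iff using d(1) v by blast
qed

lemma sum_neighbours_third_cycle_power:
  fixes h :: "int \<Rightarrow> 'a::comm_monoid_add"
  assumes n: "7 \<le> Suc m" and "u \<le> m"
  shows "(\<Sum>v\<in>{..m} - {u}. if {u, v} \<in> edges (third_cycle_power (Suc m)) then h (int v) else 0) =
    (\<Sum>d\<in>hops. h ((int u + d) mod int (Suc m)))"
proof -
  let ?E = "edges (third_cycle_power (Suc m))"
  let ?f = "\<lambda>d. nat ((int u + d) mod int (Suc m))"
  have inj: "inj_on ?f hops"
  proof (rule inj_onI)
    fix d d' assume d: "d \<in> hops" "d' \<in> hops" "?f d = ?f d'"
    then have "int (?f d) = int (?f d')" by simp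
    then have "(int u + d) mod int (Suc m) = (int u + d') mod int (Suc m)"
      by (simp del: of_nat_Suc)
    then have "int (Suc m) dvd \<bar>d - d'\<bar>" by (simp add: mod_eq_dvd_iff)
    moreover have "\<bar>d - d'\<bar> < int (Suc m)" using d n by (auto simp: hops_def)
    ultimately show "d = d'" using zdvd_not_zless[of "\<bar>d - d'\<bar>" "int (Suc m)"] by fastforce
  qed
  have "v \<le> m \<and> v \<noteq> u" if "{u, v} \<in> ?E" for v
    using that simple_third_cycle_power[of "Suc m"] n
    by (fastforce simp: simple_graph_def verts_third_cycle_power doubleton_eq_iff)
  moreover have "{u, v} \<in> ?E \<longleftrightarrow> v \<in> ?f ` hops" for v
    unfolding edge_third_cycle_power_iff[OF n] image_iff using \<open>u \<le> m\<close> by simp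
  ultimately have nb: "{v \<in> {..m} - {u}. {u, v} \<in> ?E} = ?f ` hops" by blast
  have "(\<Sum>v\<in>{..m} - {u}. if {u, v} \<in> ?E then h (int v) else 0) = (\<Sum>v\<in>?f ` hops. h (int v))"
    unfolding nb[symmetric] by (rule sum.inter_filter[symmetric]) simp
  also have "\<dots> = (\<Sum>d\<in>hops. h ((int u + d) mod int (Suc m)))"
    using inj by (simp add: sum.reindex del: of_nat_Suc)
  finally show ?thesis .
qed

text \<open>For \<open>x, y \<in> {1, 2, 3}\<close>, the values \<open>green x y + green x (- y)\<close> and \<open>green x y - green x (- y)\<close> of the
  Green function killed at the origin, with \<open>x\<close> and \<open>y\<close> shifted to indices that start at \<open>0\<close>. They act on the even and
  on the odd functions on the neighbours of the origin.\<close>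

definition even_part :: "(int \<Rightarrow> real) \<Rightarrow> nat \<Rightarrow> nat \<Rightarrow> real" where
  "even_part a i j =
    2 * a (int i + 1) + 2 * a (int j + 1) - a (int i - int j) - a (int i + int j + 2)"

definition odd_part :: "(int \<Rightarrow> real) \<Rightarrow> nat \<Rightarrow> nat \<Rightarrow> real" where
  "odd_part a i j = a (int i + int j + 2) - a (int i - int j)"

text \<open>The derivative at \<open>s = 0\<close> of the product of the determinants of \<open>I - (1 - s) P\<close> and
  \<open>I - (1 - s) Q\<close>.\<close>

definition leaf_fraction :: "(nat \<Rightarrow> nat \<Rightarrow> real) \<Rightarrow> (nat \<Rightarrow> nat \<Rightarrow> real) \<Rightarrow> real" where
  "leaf_fraction P Q =
    (trace3 P - 2 * minors3 P + 3 * det3 P) * (1 - trace3 Q + minors3 Q - det3 Q)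
    + (1 - trace3 P + minors3 P - det3 P) * (trace3 Q - 2 * minors3 Q + 3 * det3 Q)"

text \<open>On a finite graph no function has the negative indicator of one point as its Laplacian, since
  Laplacians sum to zero; the constant \<open>1 / n\<close> compensates for this. It cancels in the Green
  function, where two values of \<open>a\<close> with different arguments are subtracted.\<close>

locale potential_kernel =
  fixes n :: nat and a :: "int \<Rightarrow> real"
  assumes n: "7 \<le> n"
    and periodic: "a (x mod int n) = a x"
    and even: "a (- x) = a x"
    and zero: "a 0 = 0"
    and laplace: "6 * a x - (\<Sum>d\<in>hops. a (x + d)) = 1 / real n - of_bool (int n dvd x)"
begin

definition m :: nat where "m = n - 1"

lemma Suc_m: "Suc m = n"
  using n by (simp add: m_def)

definition vertex_weight :: "real \<Rightarrow> nat set \<Rightarrow> real" where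
  "vertex_weight s e = (if e \<in> edges (third_cycle_power n) then if m \<in> e then s else 1 else 0)"

text \<open>The inverse of the Laplacian with the row and the column of \<open>m\<close> removed: it vanishes if
  \<open>x\<close> or \<open>y\<close> is \<open>m\<close>, and its Laplacian in \<open>x\<close> away from \<open>m\<close> is the indicator of \<open>y\<close>.\<close>

definition green :: "int \<Rightarrow> int \<Rightarrow> real" where
  "green x y = a (x - int m) + a (y - int m) - a (x - y)"

text \<open>The hops are listed as \<open>1, 2, 3, -1, -2, -3\<close>, so that the reflection at \<open>m\<close> exchanges the first
  three neighbours with the last three.\<close>

definition hop :: "nat \<Rightarrow> int" where
  "hop c = (if c < 3 then int c + 1 else 2 - int c)"

definition nb :: "nat \<Rightarrow> nat" where
  "nb c = nat ((int m + hop c) mod int n)"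

lemma hop_image: "hop ` {..<6} = hops"
  by (auto simp: hop_def hops_def lessThan_nat_numeral image_iff)

lemma periodic_cong: "x mod int n = y mod int n \<Longrightarrow> a x = a y"
  by (metis periodic)

lemma edge_m_iff: "{i, m} \<in> edges (third_cycle_power n) \<longleftrightarrow> i \<in> nb ` {..<6}"
  using edge_third_cycle_power_iff[OF n, of m i] Suc_m
  by (auto simp: insert_commute nb_def simp flip: hop_image)

lemma nb_less: "c < 6 \<Longrightarrow> nb c < m"
proof -
  assume "c < 6"
  then have "{nb c, m} \<in> edges (third_cycle_power n)" using edge_m_iff by blast
  then have "nb c < n" "nb c \<noteq> m"
    using simple_third_cycle_power[of n] n
    by (fastforce simp: simple_graph_def verts_third_cycle_power doubleton_eq_iff)+
  then show "nb c < m" using Suc_m by simp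
qed

lemma nb_mod: "int (nb c) mod int n = (int m + hop c) mod int n"
  using n by (simp add: nb_def)

lemma green_nb: "green (int (nb c)) (int (nb d)) = a (hop c) + a (hop d) - a (hop c - hop d)"
proof -
  have "(int (nb c) - int m) mod int n = hop c mod int n" for c
    using mod_diff_cong[OF nb_mod[of c] refl, of "int m"] by simp
  then have "a (int (nb c) - int m) = a (hop c)" for c by (rule periodic_cong)
  moreover have "(int (nb c) - int (nb d)) mod int n = (hop c - hop d) mod int n"
    using mod_diff_cong[OF nb_mod[of c] nb_mod[of d]] by simp
  then have "a (int (nb c) - int (nb d)) = a (hop c - hop d)" by (rule periodic_cong)
  ultimately show ?thesis by (simp add: green_def)
qed

abbreviation lap :: "real \<Rightarrow> real mat" where
  "lap s \<equiv> reduced_laplacian m (vertex_weight s)"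

definition green_mat :: "real mat" where
  "green_mat = mat m m (\<lambda>(i, j). green (int i) (int j))"

definition green_nb_mat :: "real mat" where
  "green_nb_mat = mat m 6 (\<lambda>(i, c). green (int i) (int (nb c)))"

definition nb_mat :: "real mat" where
  "nb_mat = mat 6 m (\<lambda>(c, i). of_bool (i = nb c))"

lemma lap_entry:
  assumes "i < m" "j < m"
  shows "lap s $$ (i, j) = (if i = j then 6 - (1 - s) * of_bool (i \<in> nb ` {..<6})
    else - of_bool ({i, j} \<in> edges (third_cycle_power n)))"
proof (cases "i = j")
  case True
  let ?E = "edges (third_cycle_power n)"
  have card: "(\<Sum>d\<in>hops. 1) = (6::real)" by (simp add: hops_def)
  have "lap s $$ (i, i) = (\<Sum>k\<in>{..m} - {i}. (if {i, k} \<in> ?E then 1 else 0)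
      - (if m = k then (1 - s) * of_bool ({i, m} \<in> ?E) else 0))"
  proof -
    have "vertex_weight s {i, k} = (if {i, k} \<in> ?E then 1 else 0)
        - (if m = k then (1 - s) * of_bool ({i, m} \<in> ?E) else 0)" for k
      using assms by (cases "k = m") (auto simp: vertex_weight_def)
    then show ?thesis using assms by (simp add: reduced_laplacian_def)
  qed
  also have "\<dots> = (\<Sum>k\<in>{..m} - {i}. if {i, k} \<in> ?E then 1 else 0) - (1 - s) * of_bool ({i, m} \<in> ?E)"
    using assms unfolding sum_subtractf by (subst sum.delta') auto
  also have "(\<Sum>k\<in>{..m} - {i}. if {i, k} \<in> ?E then 1 else 0) = (6::real)"
    using sum_neighbours_third_cycle_power[of m i "\<lambda>_. 1 :: real"] n assms card unfolding Suc_m by simp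
  finally show ?thesis using True by (simp add: edge_m_iff)
next
  case False
  then show ?thesis using assms by (auto simp: reduced_laplacian_def vertex_weight_def)
qed

lemma lap_mult_green:
  assumes "i < m" "j < m"
  shows "(\<Sum>k = 0..<m. lap 1 $$ (i, k) * green (int k) (int j)) = of_bool (i = j)"
proof -
  let ?E = "edges (third_cycle_power n)"
  let ?g = "\<lambda>x. green x (int j)"
  \<comment> \<open>The Green function vanishes at \<open>m\<close>, so the missing column of \<open>m\<close> can be added to the sum.\<close>
  have g_m: "?g (int m) = 0"
    using even[of "int m - int j"] zero by (simp add: green_def)
  have "(\<Sum>k = 0..<m. lap 1 $$ (i, k) * ?g (int k)) =
      6 * ?g (int i) + (\<Sum>k\<in>{0..<m} - {i}. - (if {i, k} \<in> ?E then ?g (int k) else 0))"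
  proof -
    have "lap 1 $$ (i, k) * ?g (int k) = - (if {i, k} \<in> ?E then ?g (int k) else 0)"
      if "k \<in> {0..<m} - {i}" for k
      using that assms by (simp add: lap_entry)
    then have "(\<Sum>k\<in>{0..<m} - {i}. lap 1 $$ (i, k) * ?g (int k)) =
        (\<Sum>k\<in>{0..<m} - {i}. - (if {i, k} \<in> ?E then ?g (int k) else 0))"
      by (rule sum.cong[OF refl])
    then show ?thesis
      using assms by (subst sum.remove[of _ i]) (simp_all add: lap_entry)
  qed
  also have "(\<Sum>k\<in>{0..<m} - {i}. - (if {i, k} \<in> ?E then ?g (int k) else 0)) =
      (\<Sum>k\<in>{..m} - {i}. - (if {i, k} \<in> ?E then ?g (int k) else 0))"
  proof (intro sum.mono_neutral_left ballI)
    fix k assume "k \<in> {..m} - {i} - ({0..<m} - {i})"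
    then have "k = m" by auto
    then show "- (if {i, k} \<in> ?E then ?g (int k) else 0) = 0" using g_m by simp
  qed auto
  also have "\<dots> = - (\<Sum>d\<in>hops. ?g ((int i + d) mod int n))"
    using sum_neighbours_third_cycle_power[of m i ?g] n assms unfolding Suc_m
    by (simp add: sum_negf)
  also have "(\<Sum>d\<in>hops. ?g ((int i + d) mod int n)) = (\<Sum>d\<in>hops. ?g (int i + d))"
  proof (intro sum.cong refl)
    fix d
    have "a ((int i + d) mod int n - y) = a (int i + d - y)" for y
      by (intro periodic_cong) (simp add: mod_diff_left_eq)
    then show "?g ((int i + d) mod int n) = ?g (int i + d)" by (simp add: green_def)
  qed
  also have "6 * ?g (int i) + - (\<Sum>d\<in>hops. ?g (int i + d)) =
      (6 * a (int i - int m) - (\<Sum>d\<in>hops. a (int i - int m + d)))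
      - (6 * a (int i - int j) - (\<Sum>d\<in>hops. a (int i - int j + d)))"
    by (simp add: green_def hops_def algebra_simps)
  also have "\<dots> = of_bool (int n dvd int i - int j) - of_bool (int n dvd int i - int m)"
    unfolding laplace by simp
  also have "\<dots> = of_bool (i = j)"
  proof -
    have dvd: "int n dvd int x - int y \<longleftrightarrow> x = y" if "x < n" "y < n" for x y
      using that by (simp flip: mod_eq_dvd_iff)
    show ?thesis using assms Suc_m dvd[of i j] dvd[of i m] by simp
  qed
  finally show ?thesis .
qed

lemma lap_green_mat: "lap 1 * green_mat = 1\<^sub>m m"
proof (rule eq_matI)
  fix i j assume "i < dim_row (1\<^sub>m m :: real mat)" "j < dim_col (1\<^sub>m m :: real mat)"
  then show "(lap 1 * green_mat) $$ (i, j) = 1\<^sub>m m $$ (i, j)"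
    using lap_mult_green[of i j]
    by (simp add: green_mat_def reduced_laplacian_def scalar_prod_def)
qed (simp_all add: green_mat_def reduced_laplacian_def)

lemma lap_carrier: "lap s \<in> carrier_mat m m"
  by (simp add: reduced_laplacian_def)

lemma det_lap_1_nonzero: "det (lap 1) \<noteq> 0"
proof
  assume "det (lap 1) = 0"
  moreover have "det (lap 1) * det green_mat = 1"
    using det_mult[OF lap_carrier, of green_mat 1] lap_green_mat by (simp add: green_mat_def)
  ultimately show False by simp
qed

text \<open>Lowering the weight of the edges at \<open>m\<close> from \<open>1\<close> to \<open>s\<close> subtracts \<open>1 - s\<close> from the diagonal entries
  of the neighbours of \<open>m\<close>. Multiplied by the inverse of \<open>lap 1\<close>, this matrix of rank \<open>6\<close> becomes the
  product of the columns of the Green function at the neighbours with the matrix that selects the neighbours.\<close>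

lemma lap_factor: "lap s = lap 1 * (1\<^sub>m m - (1 - s) \<cdot>\<^sub>m green_nb_mat * nb_mat)"
proof (rule eq_matI)
  fix i j
  assume "i < dim_row (lap 1 * (1\<^sub>m m - (1 - s) \<cdot>\<^sub>m green_nb_mat * nb_mat))"
    "j < dim_col (lap 1 * (1\<^sub>m m - (1 - s) \<cdot>\<^sub>m green_nb_mat * nb_mat))"
  then have ij: "i < m" "j < m" by (simp_all add: reduced_laplacian_def nb_mat_def)
  \<comment> \<open>The six neighbours are distinct, as differences of hops are less than \<open>n\<close> in absolute value.\<close>
  have inj: "inj_on nb {..<6}"
  proof (rule inj_onI)
    fix c d assume cd: "c \<in> {..<6}" "d \<in> {..<6}" "nb c = nb d"
    then have "(int m + hop c) mod int n = (int m + hop d) mod int n" by (metis nb_mod)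
    then have "int n dvd \<bar>hop c - hop d\<bar>" by (simp add: mod_eq_dvd_iff)
    moreover have "\<bar>hop c - hop d\<bar> < int n" using cd n by (auto simp: hop_def)
    ultimately have "hop c = hop d" using zdvd_not_zless[of "\<bar>hop c - hop d\<bar>" "int n"] by fastforce
    then show "c = d" by (auto simp: hop_def split: if_splits)
  qed
  have entry: "(1\<^sub>m m - (1 - s) \<cdot>\<^sub>m green_nb_mat * nb_mat) $$ (k, j) =
      of_bool (k = j) - (1 - s) * (\<Sum>c = 0..<6. green (int k) (int (nb c)) * of_bool (j = nb c))"
    if "k < m" for k
    using that ij by (simp add: green_nb_mat_def nb_mat_def scalar_prod_def sum_distrib_left mult_ac
        del: sum_mult_of_bool_eq sum_of_bool_mult_eq)
  have "(lap 1 * (1\<^sub>m m - (1 - s) \<cdot>\<^sub>m green_nb_mat * nb_mat)) $$ (i, j) =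
      (\<Sum>k = 0..<m. lap 1 $$ (i, k) * (of_bool (k = j)
        - (1 - s) * (\<Sum>c = 0..<6. green (int k) (int (nb c)) * of_bool (j = nb c))))"
    using ij entry by (simp add: scalar_prod_def reduced_laplacian_def green_nb_mat_def nb_mat_def)
  also have "\<dots> = (\<Sum>k = 0..<m. lap 1 $$ (i, k) * of_bool (k = j)) - (1 - s) *
      (\<Sum>k = 0..<m. \<Sum>c = 0..<6. lap 1 $$ (i, k) * green (int k) (int (nb c)) * of_bool (j = nb c))"
    by (simp add: algebra_simps sum_subtractf sum.distrib sum_distrib_left
        del: sum_mult_of_bool_eq sum_of_bool_mult_eq)
  also have "(\<Sum>k = 0..<m. lap 1 $$ (i, k) * of_bool (k = j)) = lap 1 $$ (i, j)"
    using ij by (subst sum.remove[of _ j]) auto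
  also have "(\<Sum>k = 0..<m. \<Sum>c = 0..<6. lap 1 $$ (i, k) * green (int k) (int (nb c)) * of_bool (j = nb c))
      = (\<Sum>c = 0..<6. (\<Sum>k = 0..<m. lap 1 $$ (i, k) * green (int k) (int (nb c))) * of_bool (j = nb c))"
    unfolding sum_distrib_right by (rule sum.swap)
  also have "\<dots> = (\<Sum>c = 0..<6. of_bool (i = nb c) * of_bool (j = nb c))"
    using ij nb_less by (intro sum.cong refl) (simp add: lap_mult_green)
  also have "\<dots> = of_bool (i = j) * (\<Sum>c\<in>{..<6}. of_bool (i = nb c))"
    by (cases "i = j") (auto simp: atLeast0LessThan intro!: sum.neutral sum.cong)
  also have "(\<Sum>c\<in>{..<6}. of_bool (i = nb c)) = (\<Sum>v\<in>nb ` {..<6}. of_bool (i = v) :: real)"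
    by (rule sum.reindex[OF inj, unfolded o_def, symmetric])
  also have "\<dots> = of_bool (i \<in> nb ` {..<6})"
    by (simp add: of_bool_def sum.delta')
  finally show "lap s $$ (i, j) = (lap 1 * (1\<^sub>m m - (1 - s) \<cdot>\<^sub>m green_nb_mat * nb_mat)) $$ (i, j)"
    using ij by (simp add: lap_entry)
qed (simp_all add: reduced_laplacian_def nb_mat_def)

text \<open>The restriction of the Green function to the six neighbours has the block form of
  \<open>det_symmetric_block_mat\<close>, because \<open>a\<close> is even.\<close>

lemma det_lap:
  "det (lap s) = det (lap 1)
    * (1 - (1 - s) * trace3 (even_part a) + (1 - s)\<^sup>2 * minors3 (even_part a) - (1 - s) ^ 3 * det3 (even_part a))
    * (1 - (1 - s) * trace3 (odd_part a) + (1 - s)\<^sup>2 * minors3 (odd_part a) - (1 - s) ^ 3 * det3 (odd_part a))"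
proof -
  define t where "t = 1 - s"
  define P where "P = mat 3 3 (\<lambda>(i, j). of_bool (i = j)
    - t * (a (int i + 1) + a (int j + 1) - a (int i - int j)))"
  define Q where "Q = mat 3 3 (\<lambda>(i, j). - t * (a (int i + 1) + a (int j + 1) - a (int i + int j + 2)))"
  have PQ: "P \<in> carrier_mat 3 3" "Q \<in> carrier_mat 3 3" by (simp_all add: P_def Q_def)
  have block: "1\<^sub>m 6 - nb_mat * (t \<cdot>\<^sub>m green_nb_mat) = four_block_mat P Q Q P"
  proof (rule eq_matI)
    fix c d assume "c < dim_row (four_block_mat P Q Q P)" "d < dim_col (four_block_mat P Q Q P)"
    then have cd: "c < 6" "d < 6" using PQ by auto
    have "(nb_mat * (t \<cdot>\<^sub>m green_nb_mat)) $$ (c, d) =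
        (\<Sum>k = 0..<m. of_bool (k = nb c) * (t * green (int k) (int (nb d))))"
      using cd by (simp add: nb_mat_def green_nb_mat_def scalar_prod_def)
    also have "\<dots> = t * green (int (nb c)) (int (nb d))"
      using nb_less[OF cd(1)] by (subst sum.remove[of _ "nb c"]) auto
    finally have "(nb_mat * (t \<cdot>\<^sub>m green_nb_mat)) $$ (c, d) =
        t * (a (hop c) + a (hop d) - a (hop c - hop d))"
      by (simp add: green_nb)
    moreover have "(1\<^sub>m 6 - nb_mat * (t \<cdot>\<^sub>m green_nb_mat)) $$ (c, d) =
        of_bool (c = d) - (nb_mat * (t \<cdot>\<^sub>m green_nb_mat)) $$ (c, d)"
      using cd by (simp add: nb_mat_def green_nb_mat_def del: index_mult_mat(1))
    ultimately have "(1\<^sub>m 6 - nb_mat * (t \<cdot>\<^sub>m green_nb_mat)) $$ (c, d) =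
        of_bool (c = d) - t * (a (hop c) + a (hop d) - a (hop c - hop d))"
      by simp
    also have "\<dots> = four_block_mat P Q Q P $$ (c, d)"
    proof -
      have flip: "a (2 - int x) = a (int x - 2)" "a (1 - int x) = a (int x - 1)" for x
        using even[of "2 - int x"] even[of "1 - int x"] by simp_all
      have "a (int d - int c) = a (int c - int d)" "a (- 1 + int c + int d) = a (1 - int c - int d)"
        "a (1 - int c - int d) = a (int c + int d - 1)"
        using even[of "int d - int c"] even[of "int c + int d - 1"] by (simp_all add: algebra_simps)
      then show ?thesis
        using cd flip[of c] flip[of d] PQ
        by (auto simp: P_def Q_def hop_def of_nat_diff algebra_simps)
    qed
    finally show "(1\<^sub>m 6 - nb_mat * (t \<cdot>\<^sub>m green_nb_mat)) $$ (c, d) = four_block_mat P Q Q P $$ (c, d)" .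
  qed (use PQ in \<open>auto simp: nb_mat_def green_nb_mat_def\<close>)
  have car: "t \<cdot>\<^sub>m green_nb_mat \<in> carrier_mat m 6" "nb_mat \<in> carrier_mat 6 m"
    by (simp_all add: green_nb_mat_def nb_mat_def)
  have car': "1\<^sub>m m - t \<cdot>\<^sub>m green_nb_mat * nb_mat \<in> carrier_mat m m"
    by (intro minus_carrier_mat mult_carrier_mat[OF car])
  have "det (lap s) = det (lap 1) * det (1\<^sub>m m - t \<cdot>\<^sub>m green_nb_mat * nb_mat)"
    unfolding t_def by (subst lap_factor[of s]) (rule det_mult[OF lap_carrier car'[unfolded t_def]])
  also have "det (1\<^sub>m m - t \<cdot>\<^sub>m green_nb_mat * nb_mat) = det (P + Q) * det (P - Q)"
    unfolding det_one_minus_mult_commute[OF car(1,2)] block by (rule det_symmetric_block_mat[OF PQ])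
  also have "P + Q = mat 3 3 (\<lambda>(i, j). of_bool (i = j) - t * even_part a i j)"
    by (intro eq_matI) (auto simp: P_def Q_def even_part_def algebra_simps)
  also have "P - Q = mat 3 3 (\<lambda>(i, j). of_bool (i = j) - t * odd_part a i j)"
    by (intro eq_matI) (auto simp: P_def Q_def odd_part_def algebra_simps)
  finally show ?thesis by (simp add: det_one_minus_smult_3 t_def)
qed

text \<open>Two expressions for the number of spanning trees in which \<open>m\<close> is a leaf: the derivative at \<open>0\<close> of the
  degree generating function, once as a sum over trees and once through \<open>det_lap\<close>.\<close>

theorem BZ_seq_eq:
  "BZ_seq (\<lambda>n. graph_power (cycle_graph n) 3) n =
    leaf_fraction (even_part a) (odd_part a)"
    (is "_ = ?rhs")
proof -
  let ?G = "third_cycle_power n"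
  have G: "simple_graph ?G" "verts ?G = {..m}"
    using simple_third_cycle_power[of n] n Suc_m by (auto simp: verts_third_cycle_power)
  have gen: "(\<Sum>T\<in>spanning_trees ?G. s ^ Defs.degree T m) = det (lap s)" for s
    using edge_weighted_tree_sum_vertex[OF G, of s] by (simp add: vertex_weight_def[abs_def])
  have tau: "real (num_spanning_trees ?G) = det (lap 1)"
    using gen[of 1] by (simp add: num_spanning_trees_def)
  have "((\<lambda>s. det (lap s)) has_real_derivative
      real (card {T \<in> spanning_trees ?G. Defs.degree T m = 1})) (at 0)"
    using has_real_derivative_sum_power_at_0[OF finite_spanning_trees[OF G(1)], of "\<lambda>T. Defs.degree T m"]
    unfolding gen .
  moreover have "((\<lambda>s. det (lap s)) has_real_derivative det (lap 1) * ?rhs) (at 0)"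
    by (subst det_lap) (auto intro!: derivative_eq_intros simp: leaf_fraction_def algebra_simps)
  ultimately have "real (card {T \<in> spanning_trees ?G. Defs.degree T m = 1}) = det (lap 1) * ?rhs"
    by (rule DERIV_unique)
  moreover have "{T \<in> spanning_trees ?G. m \<in> leaves T} = {T \<in> spanning_trees ?G. Defs.degree T m = 1}"
    using G(2) by (auto simp: leaves_def spanning_trees_def)
  ultimately show ?thesis
    using BZ_seq_cycle_power[of n m 3] n Suc_m tau det_lap_1_nonzero
    by (simp add: third_cycle_power_def)
qed

end

section \<open>The potential kernel in closed form\<close>

lemma residue_bounds:
  assumes "0 < n" "\<not> int n dvd x"
  shows "0 < nat (x mod int n)" "nat (x mod int n) < n"
proof -
  have "0 \<le> x mod int n" "x mod int n < int n" using assms(1) by simp_all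
  moreover have "x mod int n \<noteq> 0" using assms(2) by (simp add: dvd_eq_mod_eq_0)
  ultimately show "0 < nat (x mod int n)" "nat (x mod int n) < n" by linarith+
qed

text \<open>A function on \<open>{0..n}\<close> with equal values at both ends gives a periodic function on the integers that
  satisfies at \<open>x\<close> the same neighbour relation, except at the multiples of \<open>n\<close>.\<close>

lemma cyclic_neighbour_sum:
  fixes f :: "nat \<Rightarrow> 'a::ab_semigroup_add"
  assumes n: "2 \<le> n" and wrap: "f n = f 0"
  shows "f (nat ((x + 1) mod int n)) + f (nat ((x - 1) mod int n)) =
    (if int n dvd x then f 1 + f (n - 1)
     else f (nat (x mod int n) + 1) + f (nat (x mod int n) - 1))"
proof -
  define k where "k = nat (x mod int n)"
  have k: "int k = x mod int n" "k < n" using n by (simp_all add: k_def nat_less_iff)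
  have "(x + 1) mod int n = (int k + 1) mod int n" unfolding k(1) by (simp add: mod_add_left_eq)
  also have "\<dots> = (if k + 1 = n then 0 else int (k + 1))"
  proof (cases "k + 1 = n")
    case True
    then have "int k + 1 = int n" by linarith
    then have "(int k + 1) mod int n = 0" by (simp only: mod_self)
    then show ?thesis using True by simp
  qed (use k(2) in simp)
  finally have up: "f (nat ((x + 1) mod int n)) = f (k + 1)"
    using wrap by (cases "k + 1 = n") (simp_all add: nat_add_distrib)
  have "(x - 1) mod int n = (int k - 1) mod int n" unfolding k(1) by (simp add: mod_diff_left_eq)
  also have "\<dots> = (if k = 0 then int (n - 1) else int (k - 1))"
    using k(2) n zmod_minus1[of "int n"] by (auto simp: of_nat_diff)
  finally have down: "f (nat ((x - 1) mod int n)) = f (if k = 0 then n - 1 else k - 1)"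
    by (cases "k = 0") (simp_all add: nat_diff_distrib)
  have "int n dvd x \<longleftrightarrow> k = 0" unfolding dvd_eq_mod_eq_0 k(1)[symmetric] by simp
  then show ?thesis unfolding up down k_def[symmetric] by auto
qed

text \<open>With \<open>X\<close> for the operator \<open>f \<mapsto> (\<lambda>x. f (x + 1) + f (x - 1))\<close>, the left-hand side is
  \<open>- (X - 2) (X^2 + 3 X + 4)\<close> applied to \<open>f\<close>. If \<open>f\<close> is an eigenfunction of \<open>X\<close> up to \<open>\<delta>\<close> and \<open>c\<close>, then the powers of
  \<open>X\<close> can be evaluated. The first term vanishes for \<open>\<beta> = 2\<close> and for \<open>\<beta> = \<alpha>\<close> below.\<close>

lemma laplace_of_neighbour_sum:
  fixes f \<delta> :: "int \<Rightarrow> 'a::idom"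
  assumes nb: "\<And>x. f (x + 1) + f (x - 1) = \<beta> * f x + \<delta> x + c"
  shows "6 * f x - (\<Sum>d\<in>hops. f (x + d)) =
    - (\<beta> - 2) * (\<beta>\<^sup>2 + 3 * \<beta> + 4) * f x
    - (\<delta> (x + 2) + 2 * \<delta> x + \<delta> (x - 2) + (\<beta> + 1) * (\<delta> (x + 1) + \<delta> (x - 1)) + (\<beta>\<^sup>2 + \<beta> - 2) * \<delta> x)
    - c * (\<beta>\<^sup>2 + 3 * \<beta> + 4)"
proof -
  have s: "f (x + 3) = \<beta> * f (x + 2) + \<delta> (x + 2) + c - f (x + 1)"
    "f (x + 2) = \<beta> * f (x + 1) + \<delta> (x + 1) + c - f x"
    "f (x + 1) = \<beta> * f x + \<delta> x + c - f (x - 1)"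
    "f (x - 2) = \<beta> * f (x - 1) + \<delta> (x - 1) + c - f x"
    "f (x - 3) = \<beta> * f (x - 2) + \<delta> (x - 2) + c - f (x - 1)"
    using nb[of "x + 2"] nb[of "x + 1"] nb[of x] nb[of "x - 1"] nb[of "x - 2"]
    by (simp_all add: algebra_simps)
  have "(\<Sum>d\<in>hops. f (x + d)) =
      f (x + 3) + f (x + 2) + f (x + 1) + f (x - 1) + f (x - 2) + f (x - 3)"
    by (simp add: hops_def algebra_simps)
  then show ?thesis unfolding s by (simp add: power2_eq_square algebra_simps)
qed

text \<open>The reals \<open>\<theta>\<close> and \<open>\<theta>'\<close> are the square roots of \<open>sqrt 7 + 7 / 4\<close> and \<open>sqrt 7 - 7 / 4\<close>, the latter
  expressed through \<open>\<theta>\<close>. They are the coordinates of a square root \<open>\<sigma>\<close> of \<open>\<alpha>\<^sup>2 - 4\<close>, where \<open>\<alpha>\<close> is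
  a root of \<open>X^2 + 3 X + 4\<close>. Hence \<open>\<rho>\<close> solves \<open>\<rho> + 1 / \<rho> = \<alpha>\<close>, and \<open>\<rho> - 1 / \<rho> = \<sigma>\<close>; the sign of
  \<open>\<sigma>\<close> selects the solution inside the unit disc. The coefficient \<open>\<kappa>\<close> is
  \<open>1 / ((\<alpha> - 2) (\<alpha> - cnj \<alpha>))\<close>, the residue at \<open>\<alpha>\<close> of the reciprocal of
  \<open>(X - 2) (X^2 + 3 X + 4)\<close>; the residue at \<open>2\<close> is \<open>1 / 14\<close>.\<close>

definition \<theta> :: real where "\<theta> = sqrt (sqrt 7 + 7 / 4)"

definition \<theta>' :: real where "\<theta>' = \<theta> * (4 - sqrt 7) / 3"

definition \<alpha> :: complex where "\<alpha> = Complex (- 3 / 2) (sqrt 7 / 2)"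

definition \<sigma> :: complex where "\<sigma> = Complex \<theta>' (- \<theta>)"

definition \<rho> :: complex where "\<rho> = (\<alpha> + \<sigma>) / 2"

definition \<kappa> :: complex where "\<kappa> = Complex (- 1 / 28) (sqrt 7 / 28)"

lemma theta_sq: "\<theta> * \<theta> = sqrt 7 + 7 / 4"
  by (simp add: \<theta>_def)

lemma theta_mult_theta': "\<theta>' * \<theta> = 3 * sqrt 7 / 4"
proof -
  have "\<theta>' * \<theta> = \<theta> * \<theta> * (4 - sqrt 7) / 3" by (simp add: \<theta>'_def)
  also have "\<dots> = 3 * sqrt 7 / 4" unfolding theta_sq by (simp add: algebra_simps)
  finally show ?thesis .
qed

lemma theta'_sq: "\<theta>' * \<theta>' = sqrt 7 - 7 / 4"
proof -
  have "\<theta>' * \<theta>' = \<theta>' * \<theta> * (4 - sqrt 7) / 3" by (simp add: \<theta>'_def)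
  also have "\<dots> = sqrt 7 - 7 / 4" unfolding theta_mult_theta' by (simp add: field_simps)
  finally show ?thesis .
qed

lemma alpha_sq: "\<alpha>\<^sup>2 + 3 * \<alpha> + 4 = 0"
  by (simp add: \<alpha>_def complex_eq_iff power2_eq_square field_simps)

lemma sigma_sq: "\<sigma> * \<sigma> = \<alpha>\<^sup>2 - 4"
  using theta_sq theta'_sq theta_mult_theta'
  by (simp add: \<alpha>_def \<sigma>_def complex_eq_iff power2_eq_square algebra_simps diff_divide_distrib)

lemma rho_quadratic: "\<rho> * (\<alpha> - \<rho>) = 1"
proof -
  have "\<rho> * (\<alpha> - \<rho>) = (\<alpha>\<^sup>2 - \<sigma> * \<sigma>) / 4" by (simp add: \<rho>_def power2_eq_square field_simps)
  then show ?thesis by (simp add: sigma_sq)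
qed

lemma sqrt7_bounds: "264 / 100 < sqrt 7" "sqrt 7 < 265 / 100"
  by (rule real_less_rsqrt real_less_lsqrt; simp add: power2_eq_square)+

lemma theta_bounds: "2 < \<theta>" "\<theta> < 21 / 10"
proof -
  from sqrt7_bounds show "2 < \<theta>" "\<theta> < 21 / 10"
    unfolding \<theta>_def by (intro real_less_rsqrt real_less_lsqrt; simp add: power2_eq_square)+
qed

lemma sigma_nonzero: "\<sigma> \<noteq> 0"
  using theta_bounds(1) by (simp add: \<sigma>_def complex_eq_iff)

lemma norm_rho_less_1: "norm \<rho> < 1"
proof -
  have "2 * (135 / 100) \<le> \<theta> * (4 - sqrt 7)" "\<theta> * (4 - sqrt 7) \<le> 21 / 10 * (136 / 100)"
    using sqrt7_bounds theta_bounds by (intro mult_mono; simp)+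
  then have "\<bar>\<theta>' - 3 / 2\<bar> \<le> 6 / 10" "\<bar>sqrt 7 / 2 - \<theta>\<bar> \<le> 8 / 10"
    using sqrt7_bounds theta_bounds by (auto simp: \<theta>'_def abs_le_iff)
  then have "\<bar>Re \<rho>\<bar> + \<bar>Im \<rho>\<bar> < 1" by (simp add: \<rho>_def \<alpha>_def \<sigma>_def)
  then show ?thesis using cmod_le[of \<rho>] by linarith
qed

text \<open>For \<open>k \<le> n\<close>, the inverse of \<open>X - \<alpha>\<close> on the cycle applied to the indicator of \<open>0\<close>, that is, the sum of \<open>\<rho> ^ \<bar>k + j * n\<bar> / \<sigma>\<close> over all integers
  \<open>j\<close>.\<close>

definition decaying_part :: "nat \<Rightarrow> nat \<Rightarrow> complex" where
  "decaying_part n k = (\<rho> ^ k + \<rho> ^ (n - k)) / (\<sigma> * (1 - \<rho> ^ n))"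

text \<open>The partial fraction expansion of the inverse of \<open>(X - 2) (X^2 + 3 X + 4)\<close>, applied to the indicator of \<open>0\<close>
  minus its mean, and normalised to vanish at \<open>0\<close>. The conjugate roots \<open>\<alpha>\<close> and \<open>cnj \<alpha>\<close> contribute twice a real part, and the root \<open>2\<close>
  contributes the parabola.\<close>

definition potential :: "nat \<Rightarrow> int \<Rightarrow> real" where
  "potential n x = (let k = nat (x mod int n) in
     real k * (real n - real k) / (28 * real n) + 2 * Re (\<kappa> * (decaying_part n k - decaying_part n 0)))"

lemma rho_power_neq_1: "0 < n \<Longrightarrow> \<rho> ^ n \<noteq> 1"
  using norm_rho_less_1 power_less_one_iff[of "norm \<rho>" n]
  by (metis norm_ge_zero norm_one norm_power less_irrefl)

lemma decaying_part_neighbours: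
  assumes n: "2 \<le> n"
  defines "g \<equiv> \<lambda>x. decaying_part n (nat (x mod int n))"
  shows "g (x + 1) + g (x - 1) = \<alpha> * g x + of_bool (int n dvd x) + 0"
proof -
  let ?k = "nat (x mod int n)" and ?D = "\<sigma> * (1 - \<rho> ^ n)"
  have D: "?D \<noteq> 0" using sigma_nonzero rho_power_neq_1[of n] n by simp
  have pow: "\<rho> ^ Suc (Suc j) + \<rho> ^ j = \<alpha> * \<rho> ^ Suc j" for j
  proof -
    have "\<rho> * \<rho> + 1 = \<alpha> * \<rho>" using rho_quadratic by (simp add: algebra_simps)
    then have "\<rho> ^ j * (\<rho> * \<rho> + 1) = \<rho> ^ j * (\<alpha> * \<rho>)" by simp
    then show ?thesis by (simp add: algebra_simps)
  qed
  have "g (x + 1) + g (x - 1) = (if int n dvd x then decaying_part n 1 + decaying_part n (n - 1)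
      else decaying_part n (?k + 1) + decaying_part n (?k - 1))"
    unfolding g_def by (rule cyclic_neighbour_sum[OF n]) (simp add: decaying_part_def add.commute)
  also have "\<dots> = \<alpha> * g x + of_bool (int n dvd x)"
  proof (cases "int n dvd x")
    case True
    then have k: "?k = 0" by simp
    \<comment> \<open>At \<open>0\<close> both neighbours have the same value, and the defect of the eigenvalue equation is
      \<open>(\<rho> - 1 / \<rho>) * (1 - \<rho> ^ n)\<close>, which the denominator normalises to \<open>1\<close>.\<close>
    obtain j where j: "n = Suc (Suc j)" using n by (metis Suc_le_D add_2_eq_Suc le_Suc_ex)
    have "\<sigma> = \<rho> - (\<alpha> - \<rho>)" by (simp add: \<rho>_def field_simps)
    then have "?D = (\<rho> - (\<alpha> - \<rho>)) * (1 - \<rho> ^ n)" by simp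
    also have "\<dots> = 2 * (\<rho> + \<rho> ^ Suc j) - \<alpha> * (1 + \<rho> ^ n)
        + 2 * (\<alpha> * \<rho> ^ Suc (Suc j) - \<rho> ^ Suc (Suc (Suc j)) - \<rho> ^ Suc j)"
      by (simp add: j algebra_simps)
    also have "\<dots> = 2 * (\<rho> + \<rho> ^ Suc j) - \<alpha> * (1 + \<rho> ^ n)"
      using pow[of "Suc j"] by (simp add: algebra_simps)
    finally have "2 * (\<rho> + \<rho> ^ Suc j) = \<alpha> * (1 + \<rho> ^ n) + ?D" by simp
    then have "2 * (\<rho> + \<rho> ^ Suc j) / ?D = \<alpha> * ((1 + \<rho> ^ n) / ?D) + 1"
      using D by (simp add: divide_simps)
    moreover have "decaying_part n 1 + decaying_part n (n - 1) = 2 * (\<rho> + \<rho> ^ Suc j) / ?D"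
      by (simp add: decaying_part_def j add_divide_distrib)
    ultimately show ?thesis using True by (simp add: g_def k decaying_part_def)
  next
    case False
    then have k: "0 < ?k" "?k < n" using residue_bounds[of n x] n by simp_all
    obtain i where i: "?k = Suc i" using k(1) by (cases ?k) simp_all
    obtain j where "n - ?k = Suc j" using k(2) by (cases "n - ?k") simp_all
    note ij = i this
    then have "n - (?k + 1) = j" "n - (?k - 1) = Suc (Suc j)" by linarith+
    then have "decaying_part n (?k + 1) + decaying_part n (?k - 1) =
        ((\<rho> ^ Suc (Suc i) + \<rho> ^ i) + (\<rho> ^ Suc (Suc j) + \<rho> ^ j)) / ?D"
      unfolding decaying_part_def ij(1) by (simp add: add_divide_distrib)
    also have "\<dots> = \<alpha> * decaying_part n ?k"
      using ij unfolding pow decaying_part_def by (simp add: distrib_left)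
    finally show ?thesis using False by (simp add: g_def)
  qed
  finally show ?thesis by simp
qed

lemma parabola_neighbours:
  assumes n: "2 \<le> n"
  defines "q \<equiv> \<lambda>x. real (nat (x mod int n)) * (real n - real (nat (x mod int n))) / (2 * real n)"
  shows "q (x + 1) + q (x - 1) = 2 * q x + of_bool (int n dvd x) + (- 1 / real n)"
proof -
  let ?k = "nat (x mod int n)"
  define f where "f k = real k * (real n - real k) / (2 * real n)" for k
  have "q (x + 1) + q (x - 1) = (if int n dvd x then f 1 + f (n - 1) else f (?k + 1) + f (?k - 1))"
    unfolding q_def f_def[symmetric] by (rule cyclic_neighbour_sum[OF n]) (simp add: f_def)
  also have "\<dots> = 2 * f ?k + of_bool (int n dvd x) + (- 1 / real n)"
  proof (cases "int n dvd x")
    case True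
    then show ?thesis using n by (simp add: f_def of_nat_diff field_simps)
  next
    case False
    then have "0 < ?k" using residue_bounds[of n x] n by simp
    then have "real (?k - 1) = real ?k - 1" by (simp add: of_nat_diff)
    then show ?thesis using False n unfolding f_def by (simp add: field_simps)
  qed
  finally show ?thesis by (simp add: q_def f_def)
qed

text \<open>These are the relations of partial fractions: the sums of \<open>c * \<beta> ^ i\<close> over the three roots \<open>\<beta>\<close> with
  their residues \<open>c\<close> are \<open>0\<close>, \<open>0\<close> and \<open>1\<close> for \<open>i = 0, 1, 2\<close>.\<close>

lemma kappa_coefficients:
  "Re \<kappa> = - 1 / 28" "Re (\<kappa> * (\<alpha> + 1)) = - 3 / 28" "Re (\<kappa> * (\<alpha>\<^sup>2 + \<alpha> - 2)) = 5 / 14"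
  by (simp_all add: \<kappa>_def \<alpha>_def power2_eq_square field_simps)

text \<open>In the combination of the parabola and the decaying part, the indicators of the shifted
  points that \<open>laplace_of_neighbour_sum\<close> produces cancel, and only the one of \<open>0\<close> itself is left.\<close>

lemma potential_laplace:
  assumes n: "2 \<le> n"
  shows "6 * potential n x - (\<Sum>d\<in>hops. potential n (x + d)) = 1 / real n - of_bool (int n dvd x)"
proof -
  define g where "g = (\<lambda>x. decaying_part n (nat (x mod int n)))"
  define q where "q = (\<lambda>x. real (nat (x mod int n)) * (real n - real (nat (x mod int n))) / (2 * real n))"
  define \<delta> :: "int \<Rightarrow> real" where "\<delta> = (\<lambda>x. of_bool (int n dvd x))"
  let ?D1 = "\<delta> (x + 1) + \<delta> (x - 1)"
  let ?D2 = "\<delta> (x + 2) + 2 * \<delta> x + \<delta> (x - 2)"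
  have nb_q: "q (x + 1) + q (x - 1) = 2 * q x + \<delta> x + (- 1 / real n)" for x
    unfolding q_def \<delta>_def by (rule parabola_neighbours[OF n])
  have nb_g: "g (x + 1) + g (x - 1) = \<alpha> * g x + complex_of_real (\<delta> x) + 0" for x
    using decaying_part_neighbours[OF n, of x] by (simp add: g_def \<delta>_def)
  have pot: "potential n y = q y / 14 + 2 * Re (\<kappa> * g y) - 2 * Re (\<kappa> * decaying_part n 0)" for y
    by (simp add: potential_def q_def g_def Let_def algebra_simps)
  have Lq: "6 * q x - (\<Sum>d\<in>hops. q (x + d)) = - (?D2 + 3 * ?D1 + 4 * \<delta> x) + 14 / real n"
    unfolding laplace_of_neighbour_sum[of q, OF nb_q] by (simp add: algebra_simps)
  have Lg: "6 * g x - (\<Sum>d\<in>hops. g (x + d)) =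
      - (of_real ?D2 + (\<alpha> + 1) * of_real ?D1 + (\<alpha>\<^sup>2 + \<alpha> - 2) * of_real (\<delta> x))"
    unfolding laplace_of_neighbour_sum[of g, OF nb_g] using alpha_sq by simp
  have "6 * Re (\<kappa> * g x) - (\<Sum>d\<in>hops. Re (\<kappa> * g (x + d))) =
      Re (\<kappa> * (6 * g x - (\<Sum>d\<in>hops. g (x + d))))"
    by (simp add: hops_def algebra_simps)
  also have "\<dots> = - (?D2 * Re \<kappa> + ?D1 * Re (\<kappa> * (\<alpha> + 1)) + \<delta> x * Re (\<kappa> * (\<alpha>\<^sup>2 + \<alpha> - 2)))"
  proof -
    have "\<kappa> * - (of_real u + (\<alpha> + 1) * of_real v + (\<alpha>\<^sup>2 + \<alpha> - 2) * of_real w) =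
        - (of_real u * \<kappa> + of_real v * (\<kappa> * (\<alpha> + 1)) + of_real w * (\<kappa> * (\<alpha>\<^sup>2 + \<alpha> - 2)))" for u v w
      by (simp add: algebra_simps)
    moreover have "Re (- (of_real u * X + of_real v * Y + of_real w * Z)) = - (u * Re X + v * Re Y + w * Re Z)"
      for u v w X Y Z by simp
    ultimately have re: "Re (\<kappa> * - (of_real u + (\<alpha> + 1) * of_real v + (\<alpha>\<^sup>2 + \<alpha> - 2) * of_real w)) =
        - (u * Re \<kappa> + v * Re (\<kappa> * (\<alpha> + 1)) + w * Re (\<kappa> * (\<alpha>\<^sup>2 + \<alpha> - 2)))" for u v w
      by (simp only:)
    show ?thesis unfolding Lg by (rule re)
  qed
  also have "\<dots> = ?D2 / 28 + 3 * ?D1 / 28 - 5 * \<delta> x / 14"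
    unfolding kappa_coefficients by (simp add: algebra_simps)
  finally have LRe: "6 * Re (\<kappa> * g x) - (\<Sum>d\<in>hops. Re (\<kappa> * g (x + d))) =
      ?D2 / 28 + 3 * ?D1 / 28 - 5 * \<delta> x / 14" .
  have "6 * potential n x - (\<Sum>d\<in>hops. potential n (x + d)) =
      (6 * q x - (\<Sum>d\<in>hops. q (x + d))) / 14
      + 2 * (6 * Re (\<kappa> * g x) - (\<Sum>d\<in>hops. Re (\<kappa> * g (x + d))))"
    unfolding pot by (simp add: hops_def algebra_simps add_divide_distrib diff_divide_distrib)
  also have "\<dots> = 1 / real n - \<delta> x"
    unfolding Lq LRe by (simp add: field_simps)
  finally show ?thesis by (simp only: \<delta>_def)
qed

lemma potential_even: "potential n (- x) = potential n x" if "2 \<le> n"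
proof (cases "int n dvd x")
  case True
  then show ?thesis by (simp add: potential_def)
next
  case False
  let ?k = "nat (x mod int n)"
  have k: "?k < n" using residue_bounds[of n x] that False by simp
  have neg: "nat (- x mod int n) = n - ?k"
    using False that nat_diff_distrib'[of "int n" "x mod int n"]
    by (simp add: zmod_zminus1_eq_if dvd_eq_mod_eq_0)
  have "decaying_part n (n - ?k) = decaying_part n ?k"
    using k by (simp add: decaying_part_def add.commute)
  moreover have "real (n - ?k) * (real n - real (n - ?k)) = real ?k * (real n - real ?k)"
    using k by (simp add: of_nat_diff)
  ultimately show ?thesis unfolding potential_def Let_def neg by simp
qed

lemma potential_kernel_potential:
  assumes "7 \<le> n"
  shows "potential_kernel n (potential n)"
proof
  show "potential n (x mod int n) = potential n x" for x by (simp add: potential_def)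
  show "potential n 0 = 0" by (simp add: potential_def)
  show "potential n (- x) = potential n x" for x by (rule potential_even) (use assms in simp)
  show "6 * potential n x - (\<Sum>d\<in>hops. potential n (x + d)) = 1 / real n - of_bool (int n dvd x)" for x
    by (rule potential_laplace) (use assms in simp)
qed (rule assms)

section \<open>The limit and its closed form\<close>

lemma potential_tendsto:
  "(\<lambda>n. potential n (int k)) \<longlonglongrightarrow> real k / 28 + 2 * Re (\<kappa> * (\<rho> ^ k - 1) / \<sigma>)"
proof -
  have pow0: "(\<lambda>n. \<rho> ^ n) \<longlonglongrightarrow> 0" using norm_rho_less_1 by (rule LIMSEQ_power_zero)
  have dec: "(\<lambda>n. decaying_part n j) \<longlonglongrightarrow> \<rho> ^ j / \<sigma>" for j
  proof -
    have "(\<lambda>n. \<rho> ^ (n - j)) \<longlonglongrightarrow> 0"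
      by (rule LIMSEQ_offset[of _ j]) (simp add: pow0)
    then have "(\<lambda>n. (\<rho> ^ j + \<rho> ^ (n - j)) / (\<sigma> * (1 - \<rho> ^ n))) \<longlonglongrightarrow> (\<rho> ^ j + 0) / (\<sigma> * (1 - 0))"
      using sigma_nonzero by (intro tendsto_intros pow0) auto
    then show ?thesis by (simp add: decaying_part_def)
  qed
  have lim: "(\<lambda>n. real k / 28 - (real k)\<^sup>2 / 28 * (1 / real n)
      + 2 * Re (\<kappa> * (decaying_part n k - decaying_part n 0))) \<longlonglongrightarrow>
      real k / 28 - (real k)\<^sup>2 / 28 * 0 + 2 * Re (\<kappa> * (\<rho> ^ k / \<sigma> - \<rho> ^ 0 / \<sigma>))"
    by (intro tendsto_add tendsto_diff tendsto_mult tendsto_Re tendsto_const dec lim_1_over_n)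
  have val: "real k / 28 - (real k)\<^sup>2 / 28 * 0 + 2 * Re (\<kappa> * (\<rho> ^ k / \<sigma> - \<rho> ^ 0 / \<sigma>)) =
      real k / 28 + 2 * Re (\<kappa> * (\<rho> ^ k - 1) / \<sigma>)"
    by (simp add: diff_divide_distrib right_diff_distrib)
  have "\<forall>\<^sub>F n in sequentially. real k / 28 - (real k)\<^sup>2 / 28 * (1 / real n)
      + 2 * Re (\<kappa> * (decaying_part n k - decaying_part n 0)) = potential n (int k)"
    using eventually_gt_at_top[of k]
  proof eventually_elim
    case (elim n)
    have "real k * (real n - real k) / (28 * real n) = real k / 28 - (real k)\<^sup>2 / 28 * (1 / real n)"
      using elim by (simp add: field_simps power2_eq_square)
    then show ?case using elim by (simp add: potential_def)
  qed
  from Lim_transform_eventually[OF lim this] show ?thesis unfolding val .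
qed

lemma potential_1_tendsto: "(\<lambda>n. potential n 1) \<longlonglongrightarrow> \<theta> / 14"
proof -
  have "\<kappa> * (\<rho> - 1) = Complex (\<theta> / 28 - 1 / 56) (sqrt 7 / 56 - \<theta>' / 28) * \<sigma>"
    using theta_sq theta'_sq theta_mult_theta'
    by (simp add: \<kappa>_def \<rho>_def \<alpha>_def \<sigma>_def complex_eq_iff field_simps)
  then have "\<kappa> * (\<rho> - 1) / \<sigma> = Complex (\<theta> / 28 - 1 / 56) (sqrt 7 / 56 - \<theta>' / 28)"
    using sigma_nonzero by simp
  then show ?thesis using potential_tendsto[of 1] by simp
qed

lemma potential_2_tendsto: "(\<lambda>n. potential n 2) \<longlonglongrightarrow> \<theta> * (sqrt 7 - 1) / 21"
proof -
  \<comment> \<open>The denominator \<open>\<sigma> = \<rho> - 1 / \<rho>\<close> cancels.\<close>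
  have "\<rho>\<^sup>2 - 1 = \<rho> * \<rho> - \<rho> * (\<alpha> - \<rho>)" by (simp add: rho_quadratic power2_eq_square)
  also have "\<dots> = \<rho> * \<sigma>" by (simp add: \<rho>_def field_simps)
  finally have "\<kappa> * (\<rho>\<^sup>2 - 1) / \<sigma> = \<kappa> * \<rho>" using sigma_nonzero by simp
  moreover have "2 * Re (\<kappa> * \<rho>) = \<theta> * (sqrt 7 - 1) / 21 - 1 / 14"
    by (simp add: \<kappa>_def \<rho>_def \<alpha>_def \<sigma>_def \<theta>'_def field_simps)
  ultimately show ?thesis using potential_tendsto[of 2] by simp
qed

text \<open>Elements of the field generated by \<open>sqrt 7\<close> and \<open>\<theta>\<close>, in coordinates with respect to the basis
  \<open>1, sqrt 7, \<theta>, \<theta> * sqrt 7\<close>. With rational coordinates, identities in this field are decided by the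
  simplifier through the following rules.\<close>

definition surd :: "real \<Rightarrow> real \<Rightarrow> real \<Rightarrow> real \<Rightarrow> real" where
  "surd a b c d = a + b * sqrt 7 + \<theta> * (c + d * sqrt 7)"

lemma surd_add: "surd a b c d + surd a' b' c' d' = surd (a + a') (b + b') (c + c') (d + d')"
  by (simp add: surd_def algebra_simps)

lemma surd_diff: "surd a b c d - surd a' b' c' d' = surd (a - a') (b - b') (c - c') (d - d')"
  by (simp add: surd_def algebra_simps)

lemma surd_mult: "surd a b c d * surd a' b' c' d' =
  surd (a * a' + 7 * b * b' + 7 / 4 * (c * c' + 7 * d * d') + 7 * (c * d' + d * c'))
    (a * b' + b * a' + (c * c' + 7 * d * d') + 7 / 4 * (c * d' + d * c'))
    (a * c' + 7 * b * d' + c * a' + 7 * d * b')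
    (a * d' + b * c' + c * b' + d * a')"
proof -
  define r where "r = sqrt 7"
  have r: "r * r = 7" by (simp add: r_def)
  have "surd a b c d * surd a' b' c' d' =
      (a + b * r) * (a' + b' * r) + \<theta> * ((a + b * r) * (c' + d' * r) + (c + d * r) * (a' + b' * r))
      + \<theta> * \<theta> * ((c + d * r) * (c' + d' * r))"
    by (simp add: surd_def r_def algebra_simps)
  also have "\<dots> = (a * a' + (r * r) * b * b' + (a * b' + b * a') * r)
      + \<theta> * (a * c' + (r * r) * b * d' + c * a' + (r * r) * d * b' + (a * d' + b * c' + c * b' + d * a') * r)
      + (7 / 4 + r) * (c * c' + (r * r) * d * d') + (7 / 4 * r + r * r) * (c * d' + d * c')"
    unfolding theta_sq r_def[symmetric] by (simp add: algebra_simps)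
  finally show ?thesis unfolding r by (simp add: surd_def r_def algebra_simps)
qed

lemma surd_numeral: "numeral k * surd a b c d = surd (numeral k * a) (numeral k * b) (numeral k * c) (numeral k * d)"
  by (simp add: surd_def algebra_simps)

lemma surd_one_diff: "1 - surd a b c d = surd (1 - a) (- b) (- c) (- d)"
  by (simp add: surd_def algebra_simps)

definition limit_potential :: "int \<Rightarrow> real" where
  "limit_potential x = [surd 0 0 0 0, surd 0 0 (1 / 14) 0, surd 0 0 (- 1 / 21) (1 / 21),
     surd (1 / 2) 0 (- 1 / 42) (- 1 / 21), surd (- 1 / 2) 0 (10 / 21) (- 1 / 21),
     surd 0 0 (- 37 / 42) (8 / 21), surd (7 / 2) 0 (5 / 21) (- 2 / 3)] ! nat \<bar>x\<bar>"

text \<open>The limits at \<open>1\<close> and \<open>2\<close> come from the closed form. The Laplace equation at \<open>0, 1, 2, 3\<close> then gives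
  those at \<open>3, 4, 5, 6\<close> one after the other.\<close>

lemma potential_tendsto_limit_potential:
  assumes "\<bar>x\<bar> \<le> 6"
  shows "(\<lambda>n. potential n x) \<longlonglongrightarrow> limit_potential x"
proof -
  have inv: "(\<lambda>n. 1 / real n) \<longlonglongrightarrow> 0" by (rule lim_1_over_n)
  have ev: "\<forall>\<^sub>F n in sequentially. (7::nat) \<le> n" by (rule eventually_ge_at_top)
  have rel: "potential n 3 = 1 / 2 - 1 / real n / 2 - potential n 1 - potential n 2"
    "potential n 4 = 5 * potential n 1 - 2 * potential n 2 - potential n 3 - 1 / real n"
    "potential n 5 = 6 * potential n 2 - 2 * potential n 1 - potential n 3 - potential n 4 - 1 / real n"
    "potential n 6 = 6 * potential n 3 - potential n 1 - potential n 2 - potential n 4 - potential n 5 - 1 / real n"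
    if n: "7 \<le> n" for n
  proof -
    interpret potential_kernel n "potential n" by (rule potential_kernel_potential[OF n])
    have "\<not> int n dvd 1" "\<not> int n dvd 2" "\<not> int n dvd 3"
      using not_dvd_hop[OF n, of 1] not_dvd_hop[OF n, of 2] not_dvd_hop[OF n, of 3]
      by (simp_all add: hops_def)
    then show "potential n 3 = 1 / 2 - 1 / real n / 2 - potential n 1 - potential n 2"
      "potential n 4 = 5 * potential n 1 - 2 * potential n 2 - potential n 3 - 1 / real n"
      "potential n 5 = 6 * potential n 2 - 2 * potential n 1 - potential n 3 - potential n 4 - 1 / real n"
      "potential n 6 = 6 * potential n 3 - potential n 1 - potential n 2 - potential n 4 - potential n 5 - 1 / real n"
      using laplace[of 0] laplace[of 1] laplace[of 2] laplace[of 3]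
        even[of 1] even[of 2] even[of 3] zero by (simp_all add: hops_def)
  qed
  have lim_cong: "(\<lambda>n. potential n k) \<longlonglongrightarrow> l"
    if "f \<longlonglongrightarrow> l" "\<And>n. 7 \<le> n \<Longrightarrow> potential n k = f n" for k f l
  proof (rule Lim_transform_eventually[OF that(1)])
    show "\<forall>\<^sub>F n in sequentially. f n = potential n k"
      using ev by eventually_elim (simp add: that(2))
  qed
  have t0: "(\<lambda>n. potential n 0) \<longlonglongrightarrow> surd 0 0 0 0" by (simp add: potential_def surd_def)
  have t1: "(\<lambda>n. potential n 1) \<longlonglongrightarrow> surd 0 0 (1 / 14) 0"
    using potential_1_tendsto by (simp add: surd_def)
  have t2: "(\<lambda>n. potential n 2) \<longlonglongrightarrow> surd 0 0 (- 1 / 21) (1 / 21)"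
    using potential_2_tendsto by (simp add: surd_def algebra_simps diff_divide_distrib)
  have "(\<lambda>n. 1 / 2 - 1 / real n / 2 - potential n 1 - potential n 2) \<longlonglongrightarrow>
      1 / 2 - 0 / 2 - surd 0 0 (1 / 14) 0 - surd 0 0 (- 1 / 21) (1 / 21)"
    by (intro tendsto_intros inv t1 t2) simp
  also have "1 / 2 - 0 / 2 - surd 0 0 (1 / 14) 0 - surd 0 0 (- 1 / 21) (1 / 21) = surd (1 / 2) 0 (- 1 / 42) (- 1 / 21)"
    by (simp add: surd_def algebra_simps)
  finally have t3: "(\<lambda>n. potential n 3) \<longlonglongrightarrow> surd (1 / 2) 0 (- 1 / 42) (- 1 / 21)"
    by (rule lim_cong) (rule rel(1))
  have "(\<lambda>n. 5 * potential n 1 - 2 * potential n 2 - potential n 3 - 1 / real n) \<longlonglongrightarrow>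
      5 * surd 0 0 (1 / 14) 0 - 2 * surd 0 0 (- 1 / 21) (1 / 21) - surd (1 / 2) 0 (- 1 / 42) (- 1 / 21) - 0"
    by (intro tendsto_intros inv t1 t2 t3)
  then have "(\<lambda>n. 5 * potential n 1 - 2 * potential n 2 - potential n 3 - 1 / real n) \<longlonglongrightarrow>
      surd (- 1 / 2) 0 (10 / 21) (- 1 / 21)"
    by (simp add: surd_numeral surd_diff)
  then have t4: "(\<lambda>n. potential n 4) \<longlonglongrightarrow> surd (- 1 / 2) 0 (10 / 21) (- 1 / 21)"
    by (rule lim_cong) (rule rel(2))
  have "(\<lambda>n. 6 * potential n 2 - 2 * potential n 1 - potential n 3 - potential n 4 - 1 / real n) \<longlonglongrightarrow>
      6 * surd 0 0 (- 1 / 21) (1 / 21) - 2 * surd 0 0 (1 / 14) 0 - surd (1 / 2) 0 (- 1 / 42) (- 1 / 21)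
      - surd (- 1 / 2) 0 (10 / 21) (- 1 / 21) - 0"
    by (intro tendsto_intros inv t1 t2 t3 t4)
  then have "(\<lambda>n. 6 * potential n 2 - 2 * potential n 1 - potential n 3 - potential n 4 - 1 / real n) \<longlonglongrightarrow>
      surd 0 0 (- 37 / 42) (8 / 21)"
    by (simp add: surd_numeral surd_diff)
  then have t5: "(\<lambda>n. potential n 5) \<longlonglongrightarrow> surd 0 0 (- 37 / 42) (8 / 21)"
    by (rule lim_cong) (rule rel(3))
  have "(\<lambda>n. 6 * potential n 3 - potential n 1 - potential n 2 - potential n 4 - potential n 5 - 1 / real n) \<longlonglongrightarrow>
      6 * surd (1 / 2) 0 (- 1 / 42) (- 1 / 21) - surd 0 0 (1 / 14) 0 - surd 0 0 (- 1 / 21) (1 / 21)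
      - surd (- 1 / 2) 0 (10 / 21) (- 1 / 21) - surd 0 0 (- 37 / 42) (8 / 21) - 0"
    by (intro tendsto_intros inv t1 t2 t3 t4 t5)
  then have "(\<lambda>n. 6 * potential n 3 - potential n 1 - potential n 2 - potential n 4 - potential n 5 - 1 / real n) \<longlonglongrightarrow>
      surd (7 / 2) 0 (5 / 21) (- 2 / 3)"
    by (simp add: surd_numeral surd_diff)
  then have t6: "(\<lambda>n. potential n 6) \<longlonglongrightarrow> surd (7 / 2) 0 (5 / 21) (- 2 / 3)"
    by (rule lim_cong) (rule rel(4))
  have nonneg: "(\<lambda>n. potential n y) \<longlonglongrightarrow> limit_potential y" if y: "0 \<le> y" "y \<le> 6" for y
  proof -
    consider "y = 0" | "y = 1" | "y = 2" | "y = 3" | "y = 4" | "y = 5" | "y = 6"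
      using y by linarith
    then show ?thesis
      using t0 t1 t2 t3 t4 t5 t6 by cases (simp_all add: limit_potential_def)
  qed
  show ?thesis
  proof (cases "0 \<le> x")
    case False
    have "potential n x = potential n (- x)" if "7 \<le> n" for n
      using potential_even[of n x] that by simp
    then have "(\<lambda>n. potential n x) \<longlonglongrightarrow> limit_potential (- x)"
      using False assms by (intro lim_cong[OF nonneg[of "- x"]]) auto
    then show ?thesis by (simp add: limit_potential_def)
  qed (use nonneg assms in auto)
qed

lemma tendsto_leaf_fraction:
  assumes "\<And>i j. i < 3 \<Longrightarrow> j < 3 \<Longrightarrow> (\<lambda>n. P n i j) \<longlonglongrightarrow> P' i j"
    and "\<And>i j. i < 3 \<Longrightarrow> j < 3 \<Longrightarrow> (\<lambda>n. Q n i j) \<longlonglongrightarrow> Q' i j"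
  shows "(\<lambda>n. leaf_fraction (P n) (Q n)) \<longlonglongrightarrow> leaf_fraction P' Q'"
  unfolding leaf_fraction_def trace3_def minors3_def det3_def
  by (intro tendsto_intros assms) simp_all

text \<open>The constant \<open>1\<close> is an eigenvector of the even part with eigenvalue \<open>1\<close>, so the second summand of
  \<open>leaf_fraction\<close> vanishes and the value is the product of the two factors of the first one.\<close>

lemma leaf_fraction_limit_potential:
  "leaf_fraction (even_part limit_potential) (odd_part limit_potential) =
    surd (135 / 14) (27 / 7) (- 52 / 7) (- 5 / 7)"
proof -
  let ?P = "even_part limit_potential" and ?Q = "odd_part limit_potential"
  note surd = surd_add surd_diff surd_mult surd_numeral surd_one_diff
  have P: "?P 0 0 = surd 0 0 (1 / 3) (- 1 / 21)" "?P 0 1 = surd (- 1 / 2) 0 0 (1 / 7)"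
    "?P 0 2 = surd (3 / 2) 0 (- 1 / 3) (- 2 / 21)" "?P 1 0 = surd (- 1 / 2) 0 0 (1 / 7)"
    "?P 1 1 = surd (1 / 2) 0 (- 2 / 3) (5 / 21)" "?P 1 2 = surd 1 0 (2 / 3) (- 8 / 21)"
    "?P 2 0 = surd (3 / 2) 0 (- 1 / 3) (- 2 / 21)" "?P 2 1 = surd 1 0 (2 / 3) (- 8 / 21)"
    "?P 2 2 = surd (- 3 / 2) 0 (- 1 / 3) (10 / 21)"
    by (simp_all add: even_part_def limit_potential_def surd)
  have Q: "?Q 0 0 = surd 0 0 (- 1 / 21) (1 / 21)" "?Q 0 1 = surd (1 / 2) 0 (- 2 / 21) (- 1 / 21)"
    "?Q 0 2 = surd (- 1 / 2) 0 (11 / 21) (- 2 / 21)" "?Q 1 0 = surd (1 / 2) 0 (- 2 / 21) (- 1 / 21)"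
    "?Q 1 1 = surd (- 1 / 2) 0 (10 / 21) (- 1 / 21)" "?Q 1 2 = surd 0 0 (- 20 / 21) (8 / 21)"
    "?Q 2 0 = surd (- 1 / 2) 0 (11 / 21) (- 2 / 21)" "?Q 2 1 = surd 0 0 (- 20 / 21) (8 / 21)"
    "?Q 2 2 = surd (7 / 2) 0 (5 / 21) (- 2 / 3)"
    by (simp_all add: odd_part_def limit_potential_def surd)
  have eP: "trace3 ?P = surd (- 1) 0 (- 2 / 3) (2 / 3)"
    "minors3 ?P = surd (- 17 / 4) (- 3 / 4) (1 / 6) (47 / 42)"
    "det3 ?P = surd (- 9 / 4) (- 3 / 4) (5 / 6) (19 / 42)"
    by (simp_all add: trace3_def minors3_def det3_def P[unfolded One_nat_def] surd)
  have eQ: "trace3 ?Q = surd 3 0 (2 / 3) (- 2 / 3)"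
    "minors3 ?Q = surd (- 9 / 4) (- 5 / 4) (85 / 42) (11 / 42)"
    "det3 ?Q = surd (- 3 / 4) (- 9 / 28) (19 / 42) (5 / 42)"
    by (simp_all add: trace3_def minors3_def det3_def Q[unfolded One_nat_def] surd)
  show ?thesis unfolding leaf_fraction_def eP eQ by (simp add: surd)
qed

lemma sqrt_closed_form: "sqrt (3857 + 1684 * sqrt 7) = surd 0 0 (104 / 3) (10 / 3)"
proof (rule real_sqrt_unique)
  have "(surd 0 0 (104 / 3) (10 / 3))\<^sup>2 = surd 3857 1684 0 0"
    unfolding power2_eq_square by (simp add: surd_mult)
  then show "(surd 0 0 (104 / 3) (10 / 3))\<^sup>2 = 3857 + 1684 * sqrt 7" by (simp add: surd_def)
  show "0 \<le> surd 0 0 (104 / 3) (10 / 3)"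
    using theta_bounds by (simp add: surd_def)
qed

theorem theorem5p3p2:
  shows "BZ_exists (\<lambda>n. graph_power (cycle_graph n) 3) \<and>
    BZ (\<lambda>n. graph_power (cycle_graph n) 3) =
      3 / 7 * (45 / 2 + 9 * sqrt 7 - 1 / 2 * sqrt (3857 + 1684 * sqrt 7))"
proof -
  let ?G = "\<lambda>n. graph_power (cycle_graph n) 3"
  let ?L = "leaf_fraction (even_part limit_potential) (odd_part limit_potential)"
  have "(\<lambda>n. leaf_fraction (even_part (potential n)) (odd_part (potential n))) \<longlonglongrightarrow> ?L"
    unfolding even_part_def[abs_def] odd_part_def[abs_def]
    by (intro tendsto_leaf_fraction tendsto_intros potential_tendsto_limit_potential) auto
  moreover have "\<forall>\<^sub>F n in sequentially.
      leaf_fraction (even_part (potential n)) (odd_part (potential n)) = BZ_seq ?G n"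
    using eventually_ge_at_top[of "7::nat"]
    by eventually_elim (rule potential_kernel.BZ_seq_eq[OF potential_kernel_potential, symmetric])
  ultimately have lim: "BZ_seq ?G \<longlonglongrightarrow> ?L" by (rule Lim_transform_eventually)
  have "?L = 3 / 7 * (45 / 2 + 9 * sqrt 7 - 1 / 2 * sqrt (3857 + 1684 * sqrt 7))"
    unfolding leaf_fraction_limit_potential sqrt_closed_form by (simp add: surd_def algebra_simps)
  with lim show ?thesis
    unfolding BZ_exists_def BZ_def by (auto simp: convergent_def limI)
qed

end
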